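(* Assume the composite stochastic finite-sum setting and the composite, non-uniformly sampled S-MISO iteration described in the context. Let $q_{\min} = \min_i q_i$, $L_q = \max_i \frac{L_i-\mu}{q_i n}$ and $\sigma_q^2 = \frac1n\sum_{i=1}^n \frac{\sigma_i^2}{q_i n}$. If $(\alpha_t)_{t\ge1}$ is a positive and non-increasing sequence of step-sizes satisfying $$\alpha_1 \le \min\left\{\frac{n q_{\min}}{2}, \frac{n\mu}{4L_q}\right\}$$ (the second term being $+\infty$ if $L_q=0$), then for all $t\ge1$ $$\mathbb{E}[C_t^q] \le \left(1-\frac{\alpha_t}{n}\right)\mathbb{E}[C_{t-1}^q] + 2\left(\frac{\alpha_t}{n}\right)^2\frac{\sigma_q^2}{\mu}.$$
   Context: Setting. Let $n,p\ge1$, let $\rho$ be a random perturbation with distribution $\Gamma$, and for $i=1,\dots,n$ let $\tilde f_i(x,\rho)$ be real-valued, $x\in\mathbb{R}^p$, with $f_i(x)=\mathbb{E}_{\rho\sim\Gamma}[\tilde f_i(x,\rho)]$ finite and $\nabla f_i(x)=\mathbb{E}_\rho[\nabla\tilde f_i(x,\rho)]$ (gradients in $x$). Let $h:\mathbb{R}^p\to\mathbb{R}$ be convex (possibly non-differentiable), $f=\frac1n\sum_i f_i$ and $F=f+h$. Assumptions: for all $i$ and $\rho$, $\tilde f_i(\cdot,\rho)$ is $\mu$-strongly convex ($\mu>0$) and $L_i$-smooth (differentiable with $L_i$-Lipschitz gradient). Let $x^*$ be the unique minimizer of $F$, $\sigma_i^2=\mathbb{E}_\rho[\|\nabla\tilde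 f_i(x^*,\rho)-\nabla f_i(x^* )\|^2]<\infty$, and $z_i^*=x^*-\frac1\mu\nabla f_i(x^* )$. Let $q=(q_1,\dots,q_n)$ be a probability distribution on $\{1,\dots,n\}$ with all $q_i>0$. Write $\mathrm{prox}_{g}(z)=\arg\min_x\{\frac12\|x-z\|^2+g(x)\}$. Initialization. For each $i$ let $\tilde\rho_i\sim\Gamma$, and let $z_i^0\in\mathbb{R}^p$ and $c_i^0\in\mathbb{R}$ be such that the quadratic $d_i^0(x)=c_i^0+\frac\mu2\|x-z_i^0\|^2$ satisfies $\tilde f_i(x,\tilde\rho_i)\ge d_i^0(x)$ for all $x$. The initial data $(\tilde\rho_i,z_i^0,c_i^0)_i$ are independent of the later samples, with $\mathbb{E}\|z_i^0\|^2<\infty$ and $\mathbb{E}|c_i^0|<\infty$. Set $\bar z_0=\frac1n\sum_i z_i^0$, $x_0=\mathrm{prox}_{h/\mu}(\bar z_0)$. Iteration. For $t=1,2,\dots$: independently of the past sample $i_t\sim q$ and independently $\rho_t\sim\Gamma$. With $\alpha_t^i=\frac{\alpha_t}{q_i n}$, set, for $i=i_t$, $$z_i^t=(1-\alpha_t^i)z_i^{t-1}+\alpha_t^i\left(x_{t-1}-\tfrac1\mu\nabla\tilde f_i(x_{t-1},\rho_t)\right),$$ $$d_i^t(x)=(1-\alpha_t^i)d_i^{t-1}(x)+\alpha_t^i\left(\tilde f_i(x_{t-1},\rho_t)+\langle\nabla\tilde f_i(x_{t-1},\rho_t),x-x_{t-1}\rangle+\tfrac\mu2\|x-x_{t-1}\|^2\right),$$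 and $z_i^t=z_i^{t-1}$, $d_i^t=d_i^{t-1}$ for $i\ne i_t$. Then set $\bar z_t=\frac1n\sum_i z_i^t$ and $x_t=\mathrm{prox}_{h/\mu}(\bar z_t)$. (Each $d_i^t$ has the form constant $+\frac\mu2\|x-z_i^t\|^2$.) Let $D_t(x)=\frac1n\sum_i d_i^t(x)+h(x)$, so $x_t$ minimizes $D_t$. Lyapunov function. $$C_t^q=F(x^* )-D_t(x_t)+\frac{\mu\alpha_t}{n^2}\sum_{i=1}^n\frac{1}{q_i n}\|z_i^t-z_i^*\|^2\quad(t\ge0),$$ where for $t=0$ the symbol $\alpha_0$ denotes any fixed number with $\alpha_0\ge\alpha_1$. *)

theory Defs
  imports "HOL-Probability.Probability"
begin

definition gradient :: "('a::real_inner \<Rightarrow> real) \<Rightarrow> 'a \<Rightarrow> 'a" where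
  "gradient f x = (THE D. GDERIV f x :> D)"

definition strongly_convex :: "real \<Rightarrow> ('a::real_inner \<Rightarrow> real) \<Rightarrow> bool" where
  "strongly_convex \<mu> f \<longleftrightarrow>
     (\<forall>x y. \<forall>u\<in>{0..1}. f ((1 - u) *\<^sub>R x + u *\<^sub>R y)
        \<le> (1 - u) * f x + u * f y - \<mu> / 2 * u * (1 - u) * (norm (x - y))\<^sup>2)"

definition smooth_with :: "real \<Rightarrow> ('a::real_inner \<Rightarrow> real) \<Rightarrow> bool" where
  "smooth_with L f \<longleftrightarrow> (\<forall>x. \<exists>D. GDERIV f x :> D) \<and> L-lipschitz_on UNIV (gradient f)"

definition prox :: "('a::real_inner \<Rightarrow> real) \<Rightarrow> 'a \<Rightarrow> 'a" where
  "prox g z = (ARG_MIN (\<lambda>x. 1 / 2 * (norm (x - z))\<^sup>2 + g x) x. True)"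


locale composite_finite_sum =
  fixes n :: nat
    and \<Gamma> :: "'r measure"
    and ft :: "nat \<Rightarrow> 'a::euclidean_space \<Rightarrow> 'r \<Rightarrow> real"
    and h :: "'a \<Rightarrow> real"
    and \<mu> :: real
    and L :: "nat \<Rightarrow> real"
    and xstar :: 'a
begin

definition fi :: "nat \<Rightarrow> 'a \<Rightarrow> real" where
  "fi i x = (\<integral>r. ft i x r \<partial>\<Gamma>)"

definition F :: "'a \<Rightarrow> real" where
  "F x = 1 / real n * (\<Sum>i=1..n. fi i x) + h x"

definition gradt :: "nat \<Rightarrow> 'a \<Rightarrow> 'r \<Rightarrow> 'a" where
  "gradt i x r = gradient (\<lambda>y. ft i y r) x"

definition noise_var :: "nat \<Rightarrow> real" where
  "noise_var i = (\<integral>r. (norm (gradt i xstar r - gradient (fi i) xstar))\<^sup>2 \<partial>\<Gamma>)"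

definition zstar :: "nat \<Rightarrow> 'a" where
  "zstar i = xstar - (1 / \<mu>) *\<^sub>R gradient (fi i) xstar"

end

locale composite_problem = composite_finite_sum + Gamma: prob_space \<Gamma> +
  assumes n_ge_1: "n \<ge> 1"
    and mu_pos: "\<mu> > 0"
    and ft_strongly_convex:
      "\<And>i r. i \<in> {1..n} \<Longrightarrow> r \<in> space \<Gamma> \<Longrightarrow> strongly_convex \<mu> (\<lambda>x. ft i x r)"
    and ft_smooth:
      "\<And>i r. i \<in> {1..n} \<Longrightarrow> r \<in> space \<Gamma> \<Longrightarrow> smooth_with (L i) (\<lambda>x. ft i x r)"
    and ft_integrable: "\<And>i x. i \<in> {1..n} \<Longrightarrow> integrable \<Gamma> (ft i x)"
    and gradt_integrable: "\<And>i x. i \<in> {1..n} \<Longrightarrow> integrable \<Gamma> (gradt i x)"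
    and fi_gradient:
      "\<And>i x. i \<in> {1..n} \<Longrightarrow> GDERIV (fi i) x :> (\<integral>r. gradt i x r \<partial>\<Gamma>)"
    and h_convex: "convex_on UNIV h"
    and xstar_unique_minimizer: "\<And>y. is_arg_min F (\<lambda>_. True) y \<longleftrightarrow> y = xstar"
    and noise_integrable: "\<And>i. i \<in> {1..n} \<Longrightarrow>
      integrable \<Gamma> (\<lambda>r. (norm (gradt i xstar r - gradient (fi i) xstar))\<^sup>2)"


text \<open>The initial data are \<open>\<rho>0\<close>, \<open>z0\<close>, \<open>c0\<close>. The samples \<open>idx t\<close> and \<open>\<rho> t\<close> are the ones drawn
  at iteration \<open>t \<ge> 1\<close>; their values at \<open>t = 0\<close> play no role.\<close>

locale smiso_process = composite_finite_sum n \<Gamma> ft h \<mu> L xstar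
  for n :: nat and \<Gamma> :: "'r measure" and ft :: "nat \<Rightarrow> 'a::euclidean_space \<Rightarrow> 'r \<Rightarrow> real"
    and h :: "'a \<Rightarrow> real" and \<mu> :: real and L :: "nat \<Rightarrow> real" and xstar :: 'a +
  fixes q :: "nat pmf"
    and \<alpha> :: "nat \<Rightarrow> real"
    and \<rho>0 :: "nat \<Rightarrow> 'w \<Rightarrow> 'r"
    and z0 :: "nat \<Rightarrow> 'w \<Rightarrow> 'a"
    and c0 :: "nat \<Rightarrow> 'w \<Rightarrow> real"
    and idx :: "nat \<Rightarrow> 'w \<Rightarrow> nat"
    and \<rho> :: "nat \<Rightarrow> 'w \<Rightarrow> 'r"
begin

definition stepsize :: "nat \<Rightarrow> nat \<Rightarrow> real" where
  "stepsize t i = \<alpha> t / (pmf q i * real n)"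

definition prox_of_mean :: "(nat \<Rightarrow> 'a) \<Rightarrow> 'a" where
  "prox_of_mean v = prox (\<lambda>y. h y / \<mu>) ((1 / real n) *\<^sub>R (\<Sum>i=1..n. v i))"

primrec z :: "nat \<Rightarrow> nat \<Rightarrow> 'w \<Rightarrow> 'a" where
  "z 0 i \<omega> = z0 i \<omega>"
| "z (Suc t) i \<omega> =
     (if i = idx (Suc t) \<omega> then
        (let x = prox_of_mean (\<lambda>j. z t j \<omega>) in
         (1 - stepsize (Suc t) i) *\<^sub>R z t i \<omega>
         + stepsize (Suc t) i *\<^sub>R (x - (1 / \<mu>) *\<^sub>R gradt i x (\<rho> (Suc t) \<omega>)))
      else z t i \<omega>)"

definition x :: "nat \<Rightarrow> 'w \<Rightarrow> 'a" where
  "x t \<omega> = prox_of_mean (\<lambda>i. z t i \<omega>)"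

primrec d :: "nat \<Rightarrow> nat \<Rightarrow> 'w \<Rightarrow> 'a \<Rightarrow> real" where
  "d 0 i \<omega> y = c0 i \<omega> + \<mu> / 2 * (norm (y - z0 i \<omega>))\<^sup>2"
| "d (Suc t) i \<omega> y =
     (if i = idx (Suc t) \<omega> then
        (1 - stepsize (Suc t) i) * d t i \<omega> y
        + stepsize (Suc t) i *
            (ft i (x t \<omega>) (\<rho> (Suc t) \<omega>)
             + gradt i (x t \<omega>) (\<rho> (Suc t) \<omega>) \<bullet> (y - x t \<omega>)
             + \<mu> / 2 * (norm (y - x t \<omega>))\<^sup>2)
      else d t i \<omega> y)"

definition D :: "nat \<Rightarrow> 'w \<Rightarrow> 'a \<Rightarrow> real" where
  "D t \<omega> y = 1 / real n * (\<Sum>i=1..n. d t i \<omega> y) + h y"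

definition lyapunov :: "nat \<Rightarrow> 'w \<Rightarrow> real" where
  "lyapunov t \<omega> = F xstar - D t \<omega> (x t \<omega>)
     + \<mu> * \<alpha> t / (real n)\<^sup>2 *
         (\<Sum>i=1..n. 1 / (pmf q i * real n) * (norm (z t i \<omega> - zstar i))\<^sup>2)"

end


text \<open>The sources of randomness: the initial data (as one random element, so that no independence
  is imposed within it), and, for each iteration, its index and its perturbation.\<close>

datatype source = Initial | Index nat | Perturbation nat

locale smiso =
  smiso_process n \<Gamma> ft h \<mu> L xstar q \<alpha> \<rho>0 z0 c0 idx \<rho> +
  composite_problem n \<Gamma> ft h \<mu> L xstar +
  prob_space M
  for M :: "'w measure"
    and n :: nat and \<Gamma> :: "'r measure" and ft :: "nat \<Rightarrow> 'a::euclidean_space \<Rightarrow> 'r \<Rightarrow> real"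
    and h :: "'a \<Rightarrow> real" and \<mu> :: real and L :: "nat \<Rightarrow> real" and xstar :: 'a
    and q :: "nat pmf" and \<alpha> :: "nat \<Rightarrow> real"
    and \<rho>0 :: "nat \<Rightarrow> 'w \<Rightarrow> 'r" and z0 :: "nat \<Rightarrow> 'w \<Rightarrow> 'a" and c0 :: "nat \<Rightarrow> 'w \<Rightarrow> real"
    and idx :: "nat \<Rightarrow> 'w \<Rightarrow> nat" and \<rho> :: "nat \<Rightarrow> 'w \<Rightarrow> 'r" +
  assumes q_support: "set_pmf q = {1..n}"
    and rho0_measurable: "\<And>i. i \<in> {1..n} \<Longrightarrow> \<rho>0 i \<in> M \<rightarrow>\<^sub>M \<Gamma>"
    and rho0_distr: "\<And>i. i \<in> {1..n} \<Longrightarrow> distr M \<Gamma> (\<rho>0 i) = \<Gamma>"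
    and z0_measurable: "\<And>i. i \<in> {1..n} \<Longrightarrow> z0 i \<in> borel_measurable M"
    and z0_square_integrable: "\<And>i. i \<in> {1..n} \<Longrightarrow> integrable M (\<lambda>\<omega>. (norm (z0 i \<omega>))\<^sup>2)"
    and c0_integrable: "\<And>i. i \<in> {1..n} \<Longrightarrow> integrable M (c0 i)"
    and initial_lower_bound: "\<And>i. i \<in> {1..n} \<Longrightarrow>
      AE \<omega> in M. \<forall>y. ft i y (\<rho>0 i \<omega>) \<ge> d 0 i \<omega> y"
    and idx_measurable: "\<And>t. t \<ge> 1 \<Longrightarrow> idx t \<in> M \<rightarrow>\<^sub>M count_space UNIV"
    and idx_distr: "\<And>t. t \<ge> 1 \<Longrightarrow> distr M (count_space UNIV) (idx t) = measure_pmf q"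
    and rho_measurable: "\<And>t. t \<ge> 1 \<Longrightarrow> \<rho> t \<in> M \<rightarrow>\<^sub>M \<Gamma>"
    and rho_distr: "\<And>t. t \<ge> 1 \<Longrightarrow> distr M \<Gamma> (\<rho> t) = \<Gamma>"
    and independent: "indep_sets
      (\<lambda>s. sets (case s of
          Initial \<Rightarrow> vimage_algebra (space M) (\<lambda>\<omega>. \<lambda>i\<in>{1..n}. (\<rho>0 i \<omega>, z0 i \<omega>, c0 i \<omega>))
            (\<Pi>\<^sub>M i\<in>{1..n}. \<Gamma> \<Otimes>\<^sub>M borel \<Otimes>\<^sub>M borel)
        | Index t \<Rightarrow> vimage_algebra (space M) (idx t) (count_space UNIV)
        | Perturbation t \<Rightarrow> vimage_algebra (space M) (\<rho> t) \<Gamma>))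
      ({Initial} \<union> Index ` {1..} \<union> Perturbation ` {1..})"

end

theory Submission
  imports Defs
begin

text \<open>The surrogate \<open>D t\<close> is \<open>\<mu>\<close>-strongly convex with minimizer \<open>x t\<close>, which bounds the new minimal
  value from below by the old one, the update of the sampled \<open>d i\<close> at \<open>x t\<close>, and a multiple of the
  squared move of \<open>z i\<close>. The move is absorbed by the convexity defect of the squared distance
  of \<open>z i\<close> to \<open>zstar i\<close>, as the steps are at most \<open>1 / 2\<close>. By co-coercivity the remaining gradient
  step deviates from \<open>zstar i\<close> by at most a Bregman divergence of \<open>ft i\<close> and the noise at \<open>xstar\<close>;
  the divergence is at most what the update of \<open>d i\<close> gains, so that \<open>ft i\<close> at \<open>x t\<close> cancels and
  only products of past and fresh random variables are left. Their expectations factor by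
  independence, and optimality of \<open>xstar\<close> turns the averaged linearization of the \<open>fi i\<close> into
  \<open>F xstar\<close>.\<close>

section \<open>Smooth and strongly convex functions\<close>

text \<open>The obstacle is that \<open>ft i (x t \<omega>) (\<rho> (Suc t) \<omega>)\<close>
  couples the past and the fresh perturbation nonlinearly. Once it has cancelled, the fresh
  perturbation enters only through functions at the fixed point \<open>xstar\<close>, so the product
  rule for independent variables replaces conditional expectations.

  The constants: with \<open>a = stepsize (Suc t) i\<close>, the bound n q_min / 2 says a \<le> 1/2,
  so the defect factor 1 - a is at least the 1/2 that completing a square costs. The bound n \<mu> /
  (4 L_q) says 4 a (L i - \<mu>) \<le> \<mu> n. Its 4 is a 2 from splitting the square of a sum
  times a 2 from co-coercivity, and it makes the coefficient of the Bregman divergence at most a /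
  n. The weights 1 / (q_i n) of the Lyapunov function match q_i a^2 = (\<alpha> / n)^2 / q_i,
  whereas q_i a = \<alpha> / n does not depend on i.

  A Bochner integral of a non-integrable function is 0 by default, so integrability has to be
  settled before expectations are compared.\<close>

lemma gradient_eqI:
  assumes "GDERIV f x :> D"
  shows "gradient f x = D"
proof -
  have "E = D" if "GDERIV f x :> E" for E
  proof -
    have "(\<lambda>v. v \<bullet> E) = (\<lambda>v. v \<bullet> D)"
      using that assms has_derivative_unique unfolding gderiv_def by blast
    then have "\<forall>v. v \<bullet> E = v \<bullet> D" by meson
    then show "E = D" by (metis vector_eq_ldot inner_commute)
  qed
  then show ?thesis
    unfolding gradient_def using assms by blast
qed

lemma smooth_with_GDERIV:
  assumes "smooth_with L f"
  shows "GDERIV f x :> gradient f x"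
  using assms gradient_eqI unfolding smooth_with_def by metis

lemma GDERIV_along_line:
  assumes "GDERIV f (x + s *\<^sub>R v) :> D"
  shows "((\<lambda>s. f (x + s *\<^sub>R v)) has_real_derivative D \<bullet> v) (at s)"
proof -
  have "((\<lambda>s. x + s *\<^sub>R v) has_derivative (\<lambda>s. s *\<^sub>R v)) (at s)"
    by (auto intro!: derivative_eq_intros)
  from has_derivative_compose[OF this assms[unfolded gderiv_def]]
  show ?thesis
    by (simp add: has_field_derivative_def inner_commute mult.commute[of _ "D \<bullet> v"])
qed

text \<open>Only a one-sided minimum is available in the applications, since convexity compares
  values on a segment that starts at the point in question.\<close>

lemma DERIV_nonneg_at_right_min:
  fixes f :: "real \<Rightarrow> real"
  assumes "(f has_real_derivative D) (at 0)"
    and "\<And>s. 0 < s \<Longrightarrow> s < 1 \<Longrightarrow> f 0 \<le> f s"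
  shows "0 \<le> D"
proof (rule ccontr)
  assume "\<not> 0 \<le> D"
  then obtain e where e: "e > 0" "\<And>s. s > 0 \<Longrightarrow> s < e \<Longrightarrow> f 0 > f (0 + s)"
    using DERIV_neg_dec_right[OF assms(1)] by auto
  define s where "s = min e 1 / 2"
  have "s > 0" "s < e" "s < 1" using e(1) by (auto simp: s_def min_def)
  then show False using e(2)[of s] assms(2)[of s] by simp
qed

text \<open>\<open>h\<close> need not be differentiable. Replacing it along the segment by its chord
  only increases the objective and leaves a differentiable function that is still minimal at the
  start. This serves both for \<open>xstar\<close> and for proximal points.\<close>

lemma subgradient_at_composite_minimum:
  fixes h :: "'a::real_inner \<Rightarrow> real"
  assumes D: "GDERIV f x :> D"
    and h: "convex_on UNIV h"
    and min: "\<And>y. f x + h x \<le> f y + h y"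
  shows "h x - D \<bullet> (y - x) \<le> h y"
proof -
  define \<phi> where "\<phi> s = f (x + s *\<^sub>R (y - x)) + s * (h y - h x)" for s
  have "(\<phi> has_real_derivative D \<bullet> (y - x) + (h y - h x)) (at 0)"
    unfolding \<phi>_def using D by (auto intro!: derivative_eq_intros GDERIV_along_line)
  moreover have "\<phi> 0 \<le> \<phi> s" if "0 < s" "s < 1" for s
  proof -
    have "h (x + s *\<^sub>R (y - x)) \<le> (1 - s) * h x + s * h y"
      using convex_onD[OF h, of s x y] that by (simp add: algebra_simps)
    then show ?thesis
      using min[of "x + s *\<^sub>R (y - x)"] by (simp add: \<phi>_def algebra_simps)
  qed
  ultimately have "0 \<le> D \<bullet> (y - x) + (h y - h x)"
    by (rule DERIV_nonneg_at_right_min)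
  then show ?thesis by simp
qed

text \<open>The slack of the strong convexity inequality along the segment vanishes at the start, so
  its derivative there is nonnegative; \<open>\<phi>\<close> is this slack up to an additive
  constant.\<close>

lemma strongly_convex_first_order:
  assumes sc: "strongly_convex \<mu> f" and D: "GDERIV f x :> D"
  shows "f x + D \<bullet> (y - x) + \<mu> / 2 * (norm (y - x))\<^sup>2 \<le> f y"
proof -
  define \<phi> where "\<phi> s = s * (f y - f x) - \<mu> / 2 * s * (1 - s) * (norm (y - x))\<^sup>2
      - f (x + s *\<^sub>R (y - x))" for s
  have "(\<phi> has_real_derivative (f y - f x) - \<mu> / 2 * (norm (y - x))\<^sup>2 - D \<bullet> (y - x)) (at 0)"
    unfolding \<phi>_def using D
    by (auto intro!: derivative_eq_intros GDERIV_along_line)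
  moreover have "\<phi> 0 \<le> \<phi> s" if "0 < s" "s < 1" for s
  proof -
    have "f ((1 - s) *\<^sub>R x + s *\<^sub>R y)
        \<le> (1 - s) * f x + s * f y - \<mu> / 2 * s * (1 - s) * (norm (x - y))\<^sup>2"
      using sc that unfolding strongly_convex_def by auto
    moreover have "(1 - s) *\<^sub>R x + s *\<^sub>R y = x + s *\<^sub>R (y - x)" by (simp add: algebra_simps)
    ultimately show ?thesis
      by (simp add: \<phi>_def norm_minus_commute algebra_simps)
  qed
  ultimately have "0 \<le> (f y - f x) - \<mu> / 2 * (norm (y - x))\<^sup>2 - D \<bullet> (y - x)"
    by (rule DERIV_nonneg_at_right_min)
  then show ?thesis by simp
qed

lemma smooth_with_nonneg: "smooth_with L f \<Longrightarrow> 0 \<le> L"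
  unfolding smooth_with_def using lipschitz_on_nonneg by blast

lemma smooth_with_gradient_diff:
  assumes "smooth_with L f"
  shows "norm (gradient f y - gradient f x) \<le> L * norm (y - x)"
  using assms unfolding smooth_with_def dist_norm[symmetric]
  by (auto dest: lipschitz_onD)

lemma descent_lemma:
  assumes "smooth_with L f"
  shows "f y \<le> f x + gradient f x \<bullet> (y - x) + L / 2 * (norm (y - x))\<^sup>2"
proof -
  define v where "v = y - x"
  \<comment> \<open>By the Lipschitz bound on the gradient, the quadratic term outweighs the change
    of slope, so \<open>\<phi>\<close> decreases; this avoids integrating the gradient along the
    line.\<close>
  define \<phi> where "\<phi> s = f (x + s *\<^sub>R v) - s * (gradient f x \<bullet> v) - L / 2 * s\<^sup>2 * (norm v)\<^sup>2" for s
  have "\<exists>D. (\<phi> has_real_derivative D) (at s) \<and> D \<le> 0" if "0 \<le> s" for s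
  proof (intro exI conjI)
    have "((\<lambda>s. s * (gradient f x \<bullet> v)) has_real_derivative gradient f x \<bullet> v) (at s)"
      by (auto intro!: derivative_eq_intros)
    moreover have "((\<lambda>s. L / 2 * s\<^sup>2 * (norm v)\<^sup>2) has_real_derivative L * s * (norm v)\<^sup>2) (at s)"
      by (auto intro!: derivative_eq_intros)
    ultimately show "(\<phi> has_real_derivative gradient f (x + s *\<^sub>R v) \<bullet> v - gradient f x \<bullet> v
            - L * s * (norm v)\<^sup>2) (at s)"
      unfolding \<phi>_def
      by (intro DERIV_diff GDERIV_along_line smooth_with_GDERIV[OF assms])
    have "(gradient f (x + s *\<^sub>R v) - gradient f x) \<bullet> v
        \<le> norm (gradient f (x + s *\<^sub>R v) - gradient f x) * norm v"
      by (rule norm_cauchy_schwarz)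
    also have "\<dots> \<le> (L * norm (s *\<^sub>R v)) * norm v"
      using smooth_with_gradient_diff[OF assms, of "x + s *\<^sub>R v" x] by (intro mult_right_mono) auto
    finally show "gradient f (x + s *\<^sub>R v) \<bullet> v - gradient f x \<bullet> v - L * s * (norm v)\<^sup>2 \<le> 0"
      using that by (simp add: inner_diff_left power2_eq_square)
  qed
  then have "\<phi> 1 \<le> \<phi> 0" by (auto intro: DERIV_nonpos_imp_nonincreasing[of 0 1])
  then show ?thesis by (simp add: \<phi>_def v_def)
qed

text \<open>At a unit vector the quadratic lower and upper bounds around 0 share their linear term.
  The result makes division by \<open>L - \<mu>\<close> safe whenever the two constants
  differ.\<close>

lemma strongly_convex_smooth_le:
  fixes f :: "'a::euclidean_space \<Rightarrow> real"
  assumes sc: "strongly_convex \<mu> f" and sm: "smooth_with L f"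
  shows "\<mu> \<le> L"
proof -
  obtain b :: 'a where b: "b \<in> Basis" using nonempty_Basis by blast
  show ?thesis
    using strongly_convex_first_order[OF sc smooth_with_GDERIV[OF sm], of 0 b]
      descent_lemma[OF sm, of b 0] b by simp
qed

text \<open>Co-coercivity of the gradient of the convex, \<open>(L - \<mu>)\<close>-smooth function
  \<open>f - \<mu> / 2 * norm\<^sup>2\<close>: the right-hand side is \<open>2 * (L - \<mu>)\<close> times its Bregman divergence.\<close>

lemma strongly_convex_smooth_cocoercive:
  fixes f :: "'a::euclidean_space \<Rightarrow> real"
  assumes sc: "strongly_convex \<mu> f" and sm: "smooth_with L f"
  shows "(norm (gradient f y - gradient f x - \<mu> *\<^sub>R (y - x)))\<^sup>2
    \<le> 2 * (L - \<mu>) * (f y - f x - gradient f x \<bullet> (y - x) - \<mu> / 2 * (norm (y - x))\<^sup>2)"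
proof -
  define w where "w = gradient f y - gradient f x - \<mu> *\<^sub>R (y - x)"
  define B where "B = f y - f x - gradient f x \<bullet> (y - x) - \<mu> / 2 * (norm (y - x))\<^sup>2"
  have gy: "gradient f y = w + gradient f x + \<mu> *\<^sub>R (y - x)" by (simp add: w_def)
  \<comment> \<open>Strong convexity around \<open>x\<close> bounds f from below, and the descent
    lemma around \<open>y\<close> from above, at the common point \<open>y - s *\<^sub>R w\<close>.
    The parameter s stays free.\<close>
  have *: "s * (norm w)\<^sup>2 - (L - \<mu>) / 2 * s\<^sup>2 * (norm w)\<^sup>2 \<le> B" for s
  proof -
    have 1: "f x + gradient f x \<bullet> (y - s *\<^sub>R w - x) + \<mu> / 2 * (norm (y - s *\<^sub>R w - x))\<^sup>2
        \<le> f (y - s *\<^sub>R w)"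
      by (rule strongly_convex_first_order[OF sc smooth_with_GDERIV[OF sm]])
    have 2: "f (y - s *\<^sub>R w) \<le> f y - s * (gradient f y \<bullet> w) + L / 2 * (s\<^sup>2 * (norm w)\<^sup>2)"
      using descent_lemma[OF sm, of "y - s *\<^sub>R w" y] by (simp add: power_mult_distrib)
    have 3: "(norm (y - s *\<^sub>R w - x))\<^sup>2
        = (norm (y - x))\<^sup>2 - 2 * s * (w \<bullet> (y - x)) + s\<^sup>2 * (norm w)\<^sup>2"
      unfolding power2_norm_eq_inner
      by (simp add: inner_diff_left inner_diff_right inner_commute power2_eq_square algebra_simps)
    have 4: "gradient f y \<bullet> w = (norm w)\<^sup>2 + gradient f x \<bullet> w + \<mu> * (w \<bullet> (y - x))"
      by (subst gy) (simp add: inner_add_left inner_add_right power2_norm_eq_inner inner_commute)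
    have 5: "gradient f x \<bullet> (y - s *\<^sub>R w - x) = gradient f x \<bullet> (y - x) - s * (gradient f x \<bullet> w)"
      by (simp add: inner_diff_right)
    have "f x + (gradient f x \<bullet> (y - x) - s * (gradient f x \<bullet> w))
         + \<mu> / 2 * ((norm (y - x))\<^sup>2 - 2 * s * (w \<bullet> (y - x)) + s\<^sup>2 * (norm w)\<^sup>2)
         \<le> f y - s * ((norm w)\<^sup>2 + gradient f x \<bullet> w + \<mu> * (w \<bullet> (y - x)))
           + L / 2 * (s\<^sup>2 * (norm w)\<^sup>2)"
      using 1 2 unfolding 3 4 5 by simp
    then show ?thesis
      unfolding B_def by (simp add: field_simps)
  qed
  have "(norm w)\<^sup>2 \<le> 2 * (L - \<mu>) * B"
  proof (cases "L = \<mu>")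
    case True
    \<comment> \<open>Without curvature in excess of \<mu> the bound is linear in s, so a large s
      forces w to vanish.\<close>
    have "(norm w)\<^sup>2 = 0"
    proof (rule ccontr)
      assume "(norm w)\<^sup>2 \<noteq> 0"
      then show False
        using *[of "(B + 1) / (norm w)\<^sup>2"] True by simp
    qed
    then show ?thesis using True by simp
  next
    case False
    define l where "l = L - \<mu>"
    have l: "l > 0" using False strongly_convex_smooth_le[OF sc sm] by (simp add: l_def)
    \<comment> \<open>The value s = 1 / l maximizes the left-hand side of \<open>*\<close>.\<close>
    have "1 / l * (norm w)\<^sup>2 - l / 2 * (1 / l)\<^sup>2 * (norm w)\<^sup>2 \<le> B"
      using *[of "1 / l"] by (simp add: l_def)
    then have "(norm w)\<^sup>2 \<le> 2 * l * B"
      using l by (simp add: field_simps power2_eq_square)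
    then show ?thesis by (simp add: l_def)
  qed
  then show ?thesis by (simp add: w_def B_def)
qed

section \<open>Proximal points of convex functions\<close>

lemma GDERIV_half_norm_sq:
  "GDERIV (\<lambda>x. 1 / 2 * (norm (x - z))\<^sup>2) x :> x - z"
  unfolding gderiv_def power2_norm_eq_inner
  by (auto intro!: derivative_eq_intros simp: inner_commute)

text \<open>\<open>prox\<close> is a choice operator, so its value is a minimizer only once one is
  known to exist; hence the second hypothesis.\<close>

lemma prox_step:
  fixes g :: "'a::real_inner \<Rightarrow> real"
  assumes g: "convex_on UNIV g"
    and ex: "\<exists>p. \<forall>y. 1 / 2 * (norm (p - z))\<^sup>2 + g p \<le> 1 / 2 * (norm (y - z))\<^sup>2 + g y"
  shows "g (prox g z) - (prox g z - z) \<bullet> (y - prox g z) \<le> g y"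
proof -
  have "is_arg_min (\<lambda>x. 1 / 2 * (norm (x - z))\<^sup>2 + g x) (\<lambda>_. True) (prox g z)"
    unfolding prox_def arg_min_def
    by (rule someI_ex) (use ex in \<open>simp add: is_arg_min_linorder\<close>)
  then show ?thesis
    by (intro subgradient_at_composite_minimum[OF GDERIV_half_norm_sq[of z] g])
       (simp add: is_arg_min_linorder)
qed

text \<open>An affine minorant makes the objective coercive, so a minimizer over a large ball is
  global. Continuity of \<open>g\<close> comes from convexity in finite dimension.\<close>

lemma prox_exists:
  fixes g :: "'a::euclidean_space \<Rightarrow> real"
  assumes g: "convex_on UNIV g" and lower: "\<And>y. g a + s \<bullet> (y - a) \<le> g y"
  shows "\<exists>p. \<forall>y. 1 / 2 * (norm (p - z))\<^sup>2 + g p \<le> 1 / 2 * (norm (y - z))\<^sup>2 + g y"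
proof -
  let ?\<psi> = "\<lambda>x. 1 / 2 * (norm (x - z))\<^sup>2 + g x"
  define K where "K = g z - g a - s \<bullet> (z - a)"
  have K: "K \<ge> 0" using lower[of z] by (simp add: K_def)
  \<comment> \<open>Chosen so that r > R gives K + norm s * r \<le> r^2 / 2: outside the ball the
    quadratic beats the decrease that the minorant allows, and \<open>z\<close> itself is better.
    The 1 ensures K \<le> K * r.\<close>
  define R where "R = 2 * norm s + 2 * K + 1"
  have R: "R \<ge> 1" using K by (simp add: R_def)
  have "continuous_on UNIV g"
    by (rule convex_on_continuous[OF open_UNIV g])
  then have "continuous_on (cball z R) ?\<psi>"
    by (intro continuous_intros) (auto intro: continuous_on_subset)
  then obtain p where p: "p \<in> cball z R" "\<And>y. y \<in> cball z R \<Longrightarrow> ?\<psi> p \<le> ?\<psi> y"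
    using continuous_attains_inf[of "cball z R" ?\<psi>] R by auto
  have "?\<psi> p \<le> ?\<psi> y" for y
  proof (cases "y \<in> cball z R")
    case True
    then show ?thesis by (rule p)
  next
    case False
    define r where "r = norm (y - z)"
    have r: "r > R" using False by (simp add: r_def dist_norm norm_minus_commute)
    have "g z - K - norm s * r \<le> g z - K + s \<bullet> (y - z)"
      using norm_cauchy_schwarz[of "- s" "y - z"] by (simp add: r_def)
    also have "\<dots> \<le> g y" using lower[of y] by (simp add: K_def inner_diff_right)
    finally have "g z - K - norm s * r \<le> g y" .
    moreover have "K + norm s * r \<le> 1 / 2 * r\<^sup>2"
    proof -
      have "K * 1 \<le> K * r" using r R K by (intro mult_left_mono) auto
      then have "K + norm s * r \<le> (norm s + K) * r" by (simp add: algebra_simps)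
      also have "\<dots> \<le> (r / 2) * r" using r R by (intro mult_right_mono) (auto simp: R_def)
      finally show ?thesis by (simp add: power2_eq_square)
    qed
    ultimately have "g z \<le> ?\<psi> y" by (simp add: r_def)
    moreover have "?\<psi> p \<le> g z" using p(2)[of z] R by simp
    ultimately show ?thesis by simp
  qed
  then show ?thesis by blast
qed

section \<open>Measurability and square integrability\<close>

text \<open>Measurability is known only for each fixed first argument. Approximating
  \<open>X\<close> by simple functions reduces to countably many fixed arguments, and continuity
  carries the result to the limit.\<close>

lemma Caratheodory_measurable:
  fixes f :: "'a::euclidean_space \<Rightarrow> 'r \<Rightarrow> 'b::metric_space"
  assumes cont: "\<And>r. r \<in> space N \<Longrightarrow> continuous_on UNIV (\<lambda>x. f x r)"
    and meas: "\<And>x. f x \<in> borel_measurable N"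
    and X: "X \<in> borel_measurable M" and R: "R \<in> M \<rightarrow>\<^sub>M N"
  shows "(\<lambda>\<omega>. f (X \<omega>) (R \<omega>)) \<in> borel_measurable M"
proof -
  obtain S where S: "\<And>k. simple_function M (S k)"
      "\<And>\<omega>. \<omega> \<in> space M \<Longrightarrow> (\<lambda>k. S k \<omega>) \<longlonglongrightarrow> X \<omega>"
    using borel_measurable_implies_sequence_metric[OF X] by metis
  show ?thesis
  proof (rule borel_measurable_LIMSEQ_metric)
    fix k
    have "(\<lambda>\<omega>. f (S k \<omega>) (R \<omega>)) \<in> borel_measurable M"
    proof (rule measurable_compose_countable'[where I = "S k ` space M"])
      show "countable (S k ` space M)"
        using S(1)[of k] by (auto simp: simple_function_def countable_finite)
      show "S k \<in> M \<rightarrow>\<^sub>M count_space (S k ` space M)"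
        using S(1)[of k] measurable_simple_function[OF S(1)[of k]]
        by (auto simp: measurable_def simple_function_def)
    qed (rule measurable_compose[OF R meas])
    then show "(\<lambda>\<omega>. f (S k \<omega>) (R \<omega>)) \<in> borel_measurable M" .
  next
    fix \<omega> assume \<omega>: "\<omega> \<in> space M"
    then have "R \<omega> \<in> space N" using R by (rule measurable_space[rotated])
    with cont have "isCont (\<lambda>x. f x (R \<omega>)) (X \<omega>)"
      by (auto simp: continuous_on_eq_continuous_at)
    then show "(\<lambda>k. f (S k \<omega>) (R \<omega>)) \<longlonglongrightarrow> f (X \<omega>) (R \<omega>)"
      using S(2)[OF \<omega>] isCont_tendsto_compose by blast
  qed
qed

text \<open>Measurability is included so that the closure rules below chain by backward
  reasoning.\<close>

definition square_integrable :: "'w measure \<Rightarrow> ('w \<Rightarrow> 'b::euclidean_space) \<Rightarrow> bool" where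
  "square_integrable M f \<longleftrightarrow>
     f \<in> borel_measurable M \<and> integrable M (\<lambda>\<omega>. (norm (f \<omega>))\<^sup>2)"

lemma square_integrable_dominated:
  assumes "square_integrable M g" "f \<in> borel_measurable M"
    and "\<And>\<omega>. \<omega> \<in> space M \<Longrightarrow> norm (f \<omega>) \<le> norm (g \<omega>)"
  shows "square_integrable M f"
  unfolding square_integrable_def
proof
  show "integrable M (\<lambda>\<omega>. (norm (f \<omega>))\<^sup>2)"
  proof (rule Bochner_Integration.integrable_bound)
    show "integrable M (\<lambda>\<omega>. (norm (g \<omega>))\<^sup>2)"
      using assms(1) by (simp add: square_integrable_def)
  qed (use assms in \<open>auto intro!: AE_I2 power_mono\<close>)
qed (fact assms(2))

lemma norm_add_sq_le: "(norm (a + b))\<^sup>2 \<le> 2 * (norm a)\<^sup>2 + 2 * (norm (b :: 'b::real_inner))\<^sup>2"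
  using zero_le_power2[of "norm (a - b)"]
  by (simp add: power2_norm_eq_inner inner_add_left inner_add_right inner_diff_left
      inner_diff_right inner_commute)

lemma abs_inner_le_half_sum_sq:
  "\<bar>a \<bullet> b\<bar> \<le> 1 / 2 * (norm a)\<^sup>2 + 1 / 2 * (norm (b :: 'b::real_inner))\<^sup>2"
proof -
  have "\<bar>a \<bullet> b\<bar> \<le> norm a * norm b" by (rule Cauchy_Schwarz_ineq2)
  also have "\<dots> \<le> 1 / 2 * (norm a)\<^sup>2 + 1 / 2 * (norm b)\<^sup>2"
    using sum_squares_bound[of "norm a" "norm b"] by (simp add: power2_eq_square)
  finally show ?thesis .
qed

lemma square_integrable_add:
  assumes f: "square_integrable M f" and g: "square_integrable M g"
  shows "square_integrable M (\<lambda>\<omega>. f \<omega> + g \<omega>)"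
  unfolding square_integrable_def
proof
  have [measurable]: "f \<in> borel_measurable M" "g \<in> borel_measurable M"
    using f g by (auto simp: square_integrable_def)
  show "(\<lambda>\<omega>. f \<omega> + g \<omega>) \<in> borel_measurable M" by measurable
  show "integrable M (\<lambda>\<omega>. (norm (f \<omega> + g \<omega>))\<^sup>2)"
  proof (rule Bochner_Integration.integrable_bound)
    show "integrable M (\<lambda>\<omega>. 2 * (norm (f \<omega>))\<^sup>2 + 2 * (norm (g \<omega>))\<^sup>2)"
      using f g by (simp add: square_integrable_def)
  qed (use norm_add_sq_le in auto)
qed

lemma square_integrable_scaleR:
  "square_integrable M f \<Longrightarrow> square_integrable M (\<lambda>\<omega>. c *\<^sub>R f \<omega>)"
  by (auto simp: square_integrable_def power_mult_distrib)

lemma square_integrable_norm: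
  "square_integrable M f \<Longrightarrow> square_integrable M (\<lambda>\<omega>. norm (f \<omega>))"
  by (auto simp: square_integrable_def)

lemma square_integrable_diff:
  assumes "square_integrable M f" "square_integrable M g"
  shows "square_integrable M (\<lambda>\<omega>. f \<omega> - g \<omega>)"
  using square_integrable_add[OF assms(1) square_integrable_scaleR[OF assms(2), of "-1"]] by simp

lemma (in finite_measure) square_integrable_const: "square_integrable M (\<lambda>\<omega>. c)"
  by (simp add: square_integrable_def)

lemma (in finite_measure) square_integrable_sum:
  "(\<And>i. i \<in> I \<Longrightarrow> square_integrable M (f i)) \<Longrightarrow> square_integrable M (\<lambda>\<omega>. \<Sum>i\<in>I. f i \<omega>)"
  by (induction I rule: infinite_finite_induct)
     (auto intro: square_integrable_const square_integrable_add)

lemma square_integrable_inner: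
  assumes f: "square_integrable M f" and g: "square_integrable M g"
  shows "integrable M (\<lambda>\<omega>. f \<omega> \<bullet> g \<omega>)"
proof (rule Bochner_Integration.integrable_bound)
  have [measurable]: "f \<in> borel_measurable M" "g \<in> borel_measurable M"
    using f g by (auto simp: square_integrable_def)
  show "(\<lambda>\<omega>. f \<omega> \<bullet> g \<omega>) \<in> borel_measurable M" by measurable
  show "integrable M (\<lambda>\<omega>. 1 / 2 * (norm (f \<omega>))\<^sup>2 + 1 / 2 * (norm (g \<omega>))\<^sup>2)"
    using f g by (simp add: square_integrable_def)
qed (use abs_inner_le_half_sum_sq in auto)

lemma square_integrable_integrable_sq:
  "square_integrable M f \<Longrightarrow> integrable M (\<lambda>\<omega>. (norm (f \<omega>))\<^sup>2)"
  by (simp add: square_integrable_def)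

lemma (in finite_measure) square_integrable_integrable:
  fixes f :: "'a \<Rightarrow> 'b::euclidean_space"
  assumes "square_integrable M f"
  shows "integrable M f"
proof -
  have "integrable M (\<lambda>\<omega>. \<Sum>b\<in>Basis. (f \<omega> \<bullet> b) *\<^sub>R b)"
    by (intro Bochner_Integration.integrable_sum Bochner_Integration.integrable_scaleR_left impI
          square_integrable_inner[OF assms] square_integrable_const)
  then show ?thesis by (simp add: euclidean_representation)
qed

text \<open>A change of centre alters a quadratic of fixed curvature only by an affine function, so
  differences of its values depend linearly on \<open>z\<close>.\<close>

lemma norm_diff_sq_diff:
  "(norm (y - z))\<^sup>2 - (norm (u - z))\<^sup>2
    = (norm y)\<^sup>2 - (norm u)\<^sup>2 - 2 * (z \<bullet> (y - (u::'b::real_inner)))"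
  unfolding power2_norm_eq_inner
  by (simp add: inner_diff_left inner_diff_right inner_commute)

text \<open>Kept as an identity, because the negative last term is later spent on the move of
  \<open>z\<close>.\<close>

lemma norm_convex_combination_sq:
  "(norm ((1 - a) *\<^sub>R z + a *\<^sub>R y - (w::'b::real_inner)))\<^sup>2
    = (1 - a) * (norm (z - w))\<^sup>2 + a * (norm (y - w))\<^sup>2 - a * (1 - a) * (norm (y - z))\<^sup>2"
  unfolding power2_norm_eq_inner
  by (simp add: inner_diff_left inner_diff_right inner_add_left inner_add_right inner_commute
      algebra_simps)

lemma sum_change_one:
  fixes f g :: "'i \<Rightarrow> 'b::ab_group_add"
  assumes "finite A" "i \<in> A" "\<And>j. j \<in> A - {i} \<Longrightarrow> f j = g j"
  shows "sum f A = sum g A + (f i - g i)"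
proof -
  have "sum f (A - {i}) = sum g (A - {i})" by (rule sum.cong) (use assms(3) in auto)
  then show ?thesis
    using sum.remove[OF assms(1,2), of f] sum.remove[OF assms(1,2), of g] by simp
qed

section \<open>The composite problem\<close>

context composite_problem
begin

lemma gradient_fi:
  "i \<in> {1..n} \<Longrightarrow> gradient (fi i) u = (\<integral>r. gradt i u r \<partial>\<Gamma>)"
  by (rule gradient_eqI[OF fi_gradient])

text \<open>Optimality of \<open>xstar\<close> in first-order form. It is used three times: as the
  affine minorant that makes \<open>prox_h\<close> well defined, as a lower bound for integrability
  of \<open>h (x t \<omega>)\<close>, and in the final comparison with
  \<open>F xstar\<close>.\<close>

lemma xstar_subgradient:
  "h xstar - ((1 / real n) *\<^sub>R (\<Sum>i=1..n. gradient (fi i) xstar)) \<bullet> (y - xstar) \<le> h y"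
proof (rule subgradient_at_composite_minimum[OF _ h_convex])
  have "((\<lambda>y. \<Sum>i=1..n. fi i y) has_derivative (\<lambda>v. \<Sum>i=1..n. v \<bullet> gradient (fi i) xstar))
      (at xstar)"
    using fi_gradient gradient_fi by (intro has_derivative_sum) (auto simp: gderiv_def)
  then have "((\<lambda>y. 1 / real n * (\<Sum>i=1..n. fi i y)) has_derivative
      (\<lambda>v. 1 / real n * (\<Sum>i=1..n. v \<bullet> gradient (fi i) xstar))) (at xstar)"
    by (rule has_derivative_mult_right)
  then show "GDERIV (\<lambda>y. 1 / real n * (\<Sum>i=1..n. fi i y)) xstar
      :> (1 / real n) *\<^sub>R (\<Sum>i=1..n. gradient (fi i) xstar)"
    by (simp add: gderiv_def inner_sum_right)
  have "is_arg_min F (\<lambda>_. True) xstar" using xstar_unique_minimizer by blast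
  then show "1 / real n * (\<Sum>i=1..n. fi i xstar) + h xstar
      \<le> 1 / real n * (\<Sum>i=1..n. fi i y) + h y" for y
    by (simp add: is_arg_min_linorder F_def)
qed

abbreviation prox_h where
  "prox_h \<equiv> prox (\<lambda>y. h y / \<mu>)"

lemma prox_h_variational: "h (prox_h v) - \<mu> * ((prox_h v - v) \<bullet> (y - prox_h v)) \<le> h y"
proof -
  have conv: "convex_on UNIV (\<lambda>y. h y / \<mu>)"
    using convex_on_cmul[OF _ h_convex, of "1 / \<mu>"] mu_pos by simp
  define s where "s = - ((1 / \<mu>) *\<^sub>R (1 / real n) *\<^sub>R (\<Sum>i=1..n. gradient (fi i) xstar))"
  have "h xstar / \<mu> + s \<bullet> (y - xstar) \<le> h y / \<mu>" for y
    using divide_right_mono[OF xstar_subgradient[of y], of \<mu>] mu_pos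
    by (simp add: s_def diff_divide_distrib mult.commute)
  from mult_left_mono[OF prox_step[OF conv prox_exists[OF conv this], of v y], of \<mu>] mu_pos
  show ?thesis by (simp add: right_diff_distrib)
qed

text \<open>Each of the two variational inequalities is tested at the other proximal point; in the
  sum the values of h cancel, and Cauchy-Schwarz finishes.\<close>

lemma prox_h_nonexpansive: "norm (prox_h v - prox_h w) \<le> norm (v - w)"
proof -
  let ?p = "prox_h v" and ?p' = "prox_h w"
  have "\<mu> * ((?p - v) \<bullet> (?p' - ?p) + (?p' - w) \<bullet> (?p - ?p')) \<ge> 0"
    using prox_h_variational[of v ?p'] prox_h_variational[of w ?p] by (simp add: algebra_simps)
  then have "(?p - v) \<bullet> (?p' - ?p) + (?p' - w) \<bullet> (?p - ?p') \<ge> 0"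
    using mu_pos by (simp add: zero_le_mult_iff)
  moreover have "(?p - v) \<bullet> (?p' - ?p) + (?p' - w) \<bullet> (?p - ?p')
      = (v - w) \<bullet> (?p - ?p') - (norm (?p - ?p'))\<^sup>2"
    unfolding power2_norm_eq_inner
    by (simp add: inner_diff_left inner_diff_right inner_commute algebra_simps)
  ultimately have "norm (?p - ?p') * norm (?p - ?p') \<le> norm (v - w) * norm (?p - ?p')"
    using norm_cauchy_schwarz[of "v - w" "?p - ?p'"] by (simp add: power2_eq_square)
  then show ?thesis
    by (cases "?p = ?p'") (auto simp: mult_le_cancel_right)
qed

lemma continuous_prox_h: "continuous_on UNIV prox_h"
  by (rule lipschitz_on_continuous_on[of 1])
     (auto intro!: lipschitz_onI simp: dist_norm prox_h_nonexpansive)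

lemma continuous_h: "continuous_on UNIV h"
  by (rule convex_on_continuous[OF open_UNIV h_convex])

lemma gradt_lipschitz:
  "i \<in> {1..n} \<Longrightarrow> r \<in> space \<Gamma> \<Longrightarrow> norm (gradt i u r - gradt i v r) \<le> L i * norm (u - v)"
  unfolding gradt_def by (rule smooth_with_gradient_diff[OF ft_smooth])

lemma continuous_gradt:
  assumes "i \<in> {1..n}" "r \<in> space \<Gamma>"
  shows "continuous_on UNIV (\<lambda>u. gradt i u r)"
  using smooth_with_nonneg[OF ft_smooth[OF assms]] gradt_lipschitz[OF assms]
  by (intro lipschitz_on_continuous_on[of "L i"] lipschitz_onI) (auto simp: dist_norm)

lemma continuous_ft:
  assumes "i \<in> {1..n}" "r \<in> space \<Gamma>"
  shows "continuous_on UNIV (\<lambda>u. ft i u r)"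
proof -
  have "isCont (\<lambda>u. ft i u r) v" for v
    using smooth_with_GDERIV[OF ft_smooth[OF assms], of v]
    unfolding gderiv_def by (rule has_derivative_continuous)
  then show ?thesis by (simp add: continuous_at_imp_continuous_on)
qed

lemma ft_lower_quadratic:
  "i \<in> {1..n} \<Longrightarrow> r \<in> space \<Gamma> \<Longrightarrow>
    ft i v r + gradt i v r \<bullet> (u - v) + \<mu> / 2 * (norm (u - v))\<^sup>2 \<le> ft i u r"
  unfolding gradt_def
  by (rule strongly_convex_first_order[OF ft_strongly_convex smooth_with_GDERIV[OF ft_smooth]])

text \<open>Provides an integrable majorant at a random point \<open>u\<close>: the data at a fixed
  \<open>v\<close> separate from the squared distance to it.\<close>

lemma ft_growth:
  assumes i: "i \<in> {1..n}" and r: "r \<in> space \<Gamma>"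
  shows "\<bar>ft i u r\<bar> \<le> \<bar>ft i v r\<bar> + 1 / 2 * (norm (gradt i v r))\<^sup>2 + (L i + 1) / 2 * (norm (u - v))\<^sup>2"
proof -
  have "ft i v r + gradt i v r \<bullet> (u - v) \<le> ft i u r"
    using ft_lower_quadratic[OF i r, of v u] mu_pos
    by (smt (verit) zero_le_mult_iff zero_le_power2 divide_nonneg_pos)
  moreover have "ft i u r \<le> ft i v r + gradt i v r \<bullet> (u - v) + L i / 2 * (norm (u - v))\<^sup>2"
    unfolding gradt_def by (rule descent_lemma[OF ft_smooth[OF i r]])
  moreover have "0 \<le> L i * (norm (u - v))\<^sup>2"
    using smooth_with_nonneg[OF ft_smooth[OF i r]] by simp
  ultimately show ?thesis
    using abs_inner_le_half_sum_sq[of "gradt i v r" "u - v"] by (simp add: field_simps)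
qed

lemma gradt_square_integrable:
  assumes i: "i \<in> {1..n}"
  shows "square_integrable \<Gamma> (gradt i xstar)"
proof -
  have "square_integrable \<Gamma> (\<lambda>r. gradt i xstar r - gradient (fi i) xstar)"
    using noise_integrable[OF i] gradt_integrable[OF i, of xstar] by (auto simp: square_integrable_def)
  from square_integrable_add[OF this Gamma.square_integrable_const[of "gradient (fi i) xstar"]]
  show ?thesis by simp
qed

text \<open>The variance reduction: the deviation at \<open>u\<close> is paid for by a Bregman divergence, which
  vanishes at \<open>xstar\<close>, and by the noise at \<open>xstar\<close> only.\<close>

lemma gradient_step_deviation:
  assumes i: "i \<in> {1..n}" and r: "r \<in> space \<Gamma>"
  shows "\<mu>\<^sup>2 * (norm (u - (1 / \<mu>) *\<^sub>R gradt i u r - zstar i))\<^sup>2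
    \<le> 4 * (L i - \<mu>) * (ft i u r - ft i xstar r - gradt i xstar r \<bullet> (u - xstar)
        - \<mu> / 2 * (norm (u - xstar))\<^sup>2)
      + 2 * (norm (gradt i xstar r - gradient (fi i) xstar))\<^sup>2"
proof -
  define w where "w = gradt i u r - gradt i xstar r - \<mu> *\<^sub>R (u - xstar)"
  define e where "e = gradt i xstar r - gradient (fi i) xstar"
  \<comment> \<open>The deviation splits into the gradient difference in excess of curvature \<mu>
    and the noise at \<open>xstar\<close>; the part \<open>\<mu> *\<^sub>R (u - xstar)\<close> is
    what the step itself removes.\<close>
  have "u - (1 / \<mu>) *\<^sub>R gradt i u r - zstar i = - (1 / \<mu>) *\<^sub>R (w + e)"
    using mu_pos by (simp add: w_def e_def zstar_def algebra_simps)
  then have "\<mu>\<^sup>2 * (norm (u - (1 / \<mu>) *\<^sub>R gradt i u r - zstar i))\<^sup>2 = (norm (w + e))\<^sup>2"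
    using mu_pos by (simp add: power_divide)
  also have "\<dots> \<le> 2 * (norm w)\<^sup>2 + 2 * (norm e)\<^sup>2" by (rule norm_add_sq_le)
  also have "2 * (norm w)\<^sup>2 \<le> 4 * (L i - \<mu>) * (ft i u r - ft i xstar r
      - gradt i xstar r \<bullet> (u - xstar) - \<mu> / 2 * (norm (u - xstar))\<^sup>2)"
    using mult_left_mono[OF strongly_convex_smooth_cocoercive[OF ft_strongly_convex[OF i r]
          ft_smooth[OF i r], of u xstar], of 2]
    unfolding w_def gradt_def by linarith
  finally show ?thesis by (simp add: e_def)
qed

end

section \<open>The iteration\<close>

context smiso
begin

section \<open>The filtration generated by the sources of randomness\<close>

definition source_algebra :: "source \<Rightarrow> 'w measure" where
  "source_algebra s = (case s of
      Initial \<Rightarrow> vimage_algebra (space M) (\<lambda>\<omega>. \<lambda>i\<in>{1..n}. (\<rho>0 i \<omega>, z0 i \<omega>, c0 i \<omega>))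
        (\<Pi>\<^sub>M i\<in>{1..n}. \<Gamma> \<Otimes>\<^sub>M borel \<Otimes>\<^sub>M borel)
    | Index t \<Rightarrow> vimage_algebra (space M) (idx t) (count_space UNIV)
    | Perturbation t \<Rightarrow> vimage_algebra (space M) (\<rho> t) \<Gamma>)"

definition past_sources :: "nat \<Rightarrow> source set" where
  "past_sources t = {Initial} \<union> Index ` {1..t} \<union> Perturbation ` {1..t}"

text \<open>Given as a generated sigma-algebra, so that depending on the past is plain measurability
  and \<open>sets_past\<close> has the form in which independence of grouped sources is delivered.
  \<open>past 0\<close> contains the initial data only.\<close>

definition past :: "nat \<Rightarrow> 'w measure" where
  "past t = sigma (space M) (\<Union>s\<in>past_sources t. sets (source_algebra s))"

lemma indep_sources:
  "indep_sets (\<lambda>s. sets (source_algebra s)) ({Initial} \<union> Index ` {1..} \<union> Perturbation ` {1..})"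
  unfolding source_algebra_def by (rule independent)

lemma space_source_algebra [simp]: "space (source_algebra s) = space M"
  by (cases s) (auto simp: source_algebra_def)

lemma space_past [simp]: "space (past t) = space M"
  unfolding past_def by (rule space_measure_of) (use sets.sets_into_space in fastforce)

lemma sets_past:
  "sets (past t) = sigma_sets (space M) (\<Union>s\<in>past_sources t. sets (source_algebra s))"
  unfolding past_def by (rule sets_measure_of) (use sets.sets_into_space in fastforce)

lemma subalgebra_past_source: "s \<in> past_sources t \<Longrightarrow> subalgebra (past t) (source_algebra s)"
  unfolding subalgebra_def sets_past by auto

lemma subalgebra_past: "subalgebra M (past t)"
proof -
  have "\<forall>s\<in>{Initial} \<union> Index ` {1..} \<union> Perturbation ` {1..}. sets (source_algebra s) \<subseteq> sets M"
    using indep_sources unfolding indep_sets_def by (rule conjunct1)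
  moreover have "past_sources t \<subseteq> {Initial} \<union> Index ` {1..} \<union> Perturbation ` {1..}"
    by (auto simp: past_sources_def)
  ultimately have "sets (source_algebra s) \<subseteq> sets M" if "s \<in> past_sources t" for s
    using that by (meson subsetD)
  then show ?thesis
    unfolding subalgebra_def sets_past by (simp add: sets.sigma_sets_subset UN_least)
qed

lemma subalgebra_past_mono: "s \<le> t \<Longrightarrow> subalgebra (past t) (past s)"
proof -
  assume "s \<le> t"
  then have "past_sources s \<subseteq> past_sources t" by (auto simp: past_sources_def)
  then show ?thesis by (simp add: subalgebra_def sets_past sigma_sets_mono' UN_mono)
qed

lemma initial_measurable_past:
  assumes i: "i \<in> {1..n}"
  shows "z0 i \<in> borel_measurable (past t)" "c0 i \<in> borel_measurable (past t)"
proof -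
  let ?P = "\<Pi>\<^sub>M i\<in>{1..n}. \<Gamma> \<Otimes>\<^sub>M (borel :: 'a measure) \<Otimes>\<^sub>M (borel :: real measure)"
  let ?f = "\<lambda>\<omega>. \<lambda>i\<in>{1..n}. (\<rho>0 i \<omega>, z0 i \<omega>, c0 i \<omega>)"
  have "?f \<in> space M \<rightarrow> space ?P"
    using rho0_measurable[THEN measurable_space]
    by (auto simp: space_PiM space_pair_measure)
  then have "?f \<in> source_algebra Initial \<rightarrow>\<^sub>M ?P"
    unfolding source_algebra_def source.case by (rule measurable_vimage_algebra1)
  then have "?f \<in> past t \<rightarrow>\<^sub>M ?P"
    by (rule measurable_from_subalg[OF subalgebra_past_source, rotated])
       (simp add: past_sources_def)
  then have *: "(\<lambda>\<omega>. ?f \<omega> i) \<in> past t \<rightarrow>\<^sub>M \<Gamma> \<Otimes>\<^sub>M borel \<Otimes>\<^sub>M borel"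
    using i by (rule measurable_compose[OF _ measurable_component_singleton])
  show "z0 i \<in> borel_measurable (past t)"
    using measurable_compose[OF * measurable_compose[OF measurable_snd measurable_fst]] i by simp
  show "c0 i \<in> borel_measurable (past t)"
    using measurable_compose[OF * measurable_compose[OF measurable_snd measurable_snd]] i by simp
qed

lemma idx_measurable_past: "1 \<le> s \<Longrightarrow> s \<le> t \<Longrightarrow> idx s \<in> past t \<rightarrow>\<^sub>M count_space UNIV"
proof -
  assume s: "1 \<le> s" "s \<le> t"
  have "idx s \<in> source_algebra (Index s) \<rightarrow>\<^sub>M count_space UNIV"
    unfolding source_algebra_def source.case by (rule measurable_vimage_algebra1) auto
  then show ?thesis
    by (rule measurable_from_subalg[OF subalgebra_past_source, rotated])
       (use s in \<open>simp add: past_sources_def\<close>)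
qed

lemma rho_measurable_past: "1 \<le> s \<Longrightarrow> s \<le> t \<Longrightarrow> \<rho> s \<in> past t \<rightarrow>\<^sub>M \<Gamma>"
proof -
  assume s: "1 \<le> s" "s \<le> t"
  have "\<rho> s \<in> source_algebra (Perturbation s) \<rightarrow>\<^sub>M \<Gamma>"
    unfolding source_algebra_def source.case
    by (rule measurable_vimage_algebra1) (use rho_measurable[OF s(1), THEN measurable_space] in auto)
  then show ?thesis
    by (rule measurable_from_subalg[OF subalgebra_past_source, rotated])
       (use s in \<open>simp add: past_sources_def\<close>)
qed

lemma x_eq: "x t \<omega> = prox_h ((1 / real n) *\<^sub>R (\<Sum>i=1..n. z t i \<omega>))"
  by (simp add: x_def prox_of_mean_def)

text \<open>The recursion for \<open>z\<close> has to recompute the proximal point because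
  \<open>x\<close> is defined after it. This form replaces it as the unfolding rule.\<close>

lemma z_Suc: "z (Suc t) i \<omega> = (if i = idx (Suc t) \<omega> then
    (1 - stepsize (Suc t) i) *\<^sub>R z t i \<omega> + stepsize (Suc t) i *\<^sub>R
      (x t \<omega> - (1 / \<mu>) *\<^sub>R gradt i (x t \<omega>) (\<rho> (Suc t) \<omega>))
    else z t i \<omega>)"
  by (simp add: x_def Let_def)

declare z.simps(2) [simp del]

text \<open>Conditional on \<open>z t\<close>, since \<open>x t\<close> is needed inside the very
  induction that establishes measurability of \<open>z\<close>.\<close>

lemma x_measurable_if:
  assumes "\<And>i. i \<in> {1..n} \<Longrightarrow> z t i \<in> borel_measurable N"
  shows "x t \<in> borel_measurable N"
  unfolding x_eq[abs_def]
  by (rule borel_measurable_continuous_on[OF continuous_prox_h]) (use assms in measurable)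

lemma gradt_compose_measurable:
  assumes "i \<in> {1..n}" "X \<in> borel_measurable N" "R \<in> N \<rightarrow>\<^sub>M \<Gamma>"
  shows "(\<lambda>\<omega>. gradt i (X \<omega>) (R \<omega>)) \<in> borel_measurable N"
  by (rule Caratheodory_measurable[where f = "gradt i", OF continuous_gradt[OF assms(1)]
        borel_measurable_integrable[OF gradt_integrable[OF assms(1)]] assms(2,3)])

lemma ft_compose_measurable:
  assumes "i \<in> {1..n}" "X \<in> borel_measurable N" "R \<in> N \<rightarrow>\<^sub>M \<Gamma>"
  shows "(\<lambda>\<omega>. ft i (X \<omega>) (R \<omega>)) \<in> borel_measurable N"
  by (rule Caratheodory_measurable[where f = "ft i", OF continuous_ft[OF assms(1)]
        borel_measurable_integrable[OF ft_integrable[OF assms(1)]] assms(2,3)])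

lemma z_measurable_past: "i \<in> {1..n} \<Longrightarrow> z t i \<in> borel_measurable (past t)"
proof (induction t arbitrary: i)
  case 0
  then show ?case using initial_measurable_past by (simp add: fun_eq_iff[symmetric])
next
  case (Suc t)
  have *: "f \<in> borel_measurable (past (Suc t))" if "f \<in> borel_measurable (past t)" for f :: "'w \<Rightarrow> 'a"
    using that by (rule measurable_from_subalg[OF subalgebra_past_mono, rotated]) simp
  have [measurable]: "z t i \<in> borel_measurable (past (Suc t))" if "i \<in> {1..n}" for i
    by (rule *[OF Suc.IH[OF that]])
  have [measurable]: "x t \<in> borel_measurable (past (Suc t))"
    by (rule x_measurable_if) simp
  have [measurable]: "idx (Suc t) \<in> past (Suc t) \<rightarrow>\<^sub>M count_space UNIV"
    "\<rho> (Suc t) \<in> past (Suc t) \<rightarrow>\<^sub>M \<Gamma>"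
    by (simp_all add: idx_measurable_past rho_measurable_past)
  have [measurable]: "(\<lambda>\<omega>. gradt i (x t \<omega>) (\<rho> (Suc t) \<omega>)) \<in> borel_measurable (past (Suc t))"
    by (rule gradt_compose_measurable[OF Suc.prems]) auto
  show ?case
    unfolding z_Suc using Suc.prems by measurable
qed

lemma x_measurable_past: "x t \<in> borel_measurable (past t)"
  by (rule x_measurable_if[OF z_measurable_past])

lemma measurable_past_imp: "f \<in> past t \<rightarrow>\<^sub>M N \<Longrightarrow> f \<in> M \<rightarrow>\<^sub>M N"
  by (rule measurable_from_subalg[OF subalgebra_past])

lemma d_measurable_past: "i \<in> {1..n} \<Longrightarrow> (\<lambda>\<omega>. d t i \<omega> u) \<in> borel_measurable (past t)"
proof (induction t)
  case 0
  then show ?case using initial_measurable_past[of i 0] by simp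
next
  case (Suc t)
  have [measurable]: "(\<lambda>\<omega>. d t i \<omega> u) \<in> borel_measurable (past (Suc t))"
      "x t \<in> borel_measurable (past (Suc t))"
    using measurable_from_subalg[OF subalgebra_past_mono[of t "Suc t"]] Suc x_measurable_past by auto
  have [measurable]: "idx (Suc t) \<in> past (Suc t) \<rightarrow>\<^sub>M count_space UNIV"
    "\<rho> (Suc t) \<in> past (Suc t) \<rightarrow>\<^sub>M \<Gamma>"
    by (simp_all add: idx_measurable_past rho_measurable_past)
  have [measurable]: "(\<lambda>\<omega>. gradt i (x t \<omega>) (\<rho> (Suc t) \<omega>)) \<in> borel_measurable (past (Suc t))"
     "(\<lambda>\<omega>. ft i (x t \<omega>) (\<rho> (Suc t) \<omega>)) \<in> borel_measurable (past (Suc t))"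
    by (rule gradt_compose_measurable ft_compose_measurable; use Suc.prems in measurable)+
  show ?case
    unfolding d.simps by measurable
qed

text \<open>Each \<open>d t i \<omega>\<close> is a quadratic of curvature \<mu> centred at
  \<open>z t i \<omega>\<close>. Stating this for differences avoids tracking its additive
  constant.\<close>

lemma d_quadratic:
  "d t i \<omega> y - d t i \<omega> u = \<mu> / 2 * ((norm y)\<^sup>2 - (norm u)\<^sup>2) - \<mu> * (z t i \<omega> \<bullet> (y - u))"
proof (induction t)
  case 0
  have "d 0 i \<omega> y - d 0 i \<omega> u = \<mu> / 2 * ((norm (y - z0 i \<omega>))\<^sup>2 - (norm (u - z0 i \<omega>))\<^sup>2)"
    by (simp add: algebra_simps)
  then show ?case unfolding norm_diff_sq_diff by (simp add: algebra_simps)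
next
  case (Suc t)
  show ?case
  proof (cases "i = idx (Suc t) \<omega>")
    case False
    then show ?thesis using Suc by (simp add: z_Suc)
  next
    case True
    let ?a = "stepsize (Suc t) i" and ?X = "x t \<omega>"
    let ?g = "gradt i ?X (\<rho> (Suc t) \<omega>)"
    have "d (Suc t) i \<omega> y - d (Suc t) i \<omega> u
        = (1 - ?a) * (d t i \<omega> y - d t i \<omega> u)
          + ?a * (?g \<bullet> (y - u) + \<mu> / 2 * ((norm (y - ?X))\<^sup>2 - (norm (u - ?X))\<^sup>2))"
      using True by (simp add: algebra_simps inner_diff_right)
    also have "\<dots> = (1 - ?a) * (\<mu> / 2 * ((norm y)\<^sup>2 - (norm u)\<^sup>2) - \<mu> * (z t i \<omega> \<bullet> (y - u)))
          + ?a * (?g \<bullet> (y - u) + \<mu> / 2 * ((norm y)\<^sup>2 - (norm u)\<^sup>2 - 2 * (?X \<bullet> (y - u))))"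
      unfolding norm_diff_sq_diff Suc ..
    also have "\<dots> = \<mu> / 2 * ((norm y)\<^sup>2 - (norm u)\<^sup>2)
        - \<mu> * ((1 - ?a) * (z t i \<omega> \<bullet> (y - u))
            + ?a * (?X \<bullet> (y - u) - (1 / \<mu>) * (?g \<bullet> (y - u))))"
      using mu_pos by (simp add: field_simps)
    \<comment> \<open>Averaging quadratics of equal curvature averages their centres, and the centre
      of the new model is the gradient step \<open>?X - (1 / \<mu>) *\<^sub>R ?g\<close>.\<close>
    also have "(1 - ?a) * (z t i \<omega> \<bullet> (y - u)) + ?a * (?X \<bullet> (y - u) - (1 / \<mu>) * (?g \<bullet> (y - u)))
        = z (Suc t) i \<omega> \<bullet> (y - u)"
      using True by (simp add: z_Suc inner_add_left inner_diff_left)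
    finally show ?thesis .
  qed
qed

section \<open>Integrability of the iterates, the surrogates and the Lyapunov function\<close>

lemma rho_compose_integrable:
  fixes v :: "_ \<Rightarrow> 'e::{banach, second_countable_topology}"
  assumes "1 \<le> t" "integrable \<Gamma> v"
  shows "integrable M (\<lambda>\<omega>. v (\<rho> t \<omega>))" "(\<integral>\<omega>. v (\<rho> t \<omega>) \<partial>M) = (\<integral>r. v r \<partial>\<Gamma>)"
proof -
  show "integrable M (\<lambda>\<omega>. v (\<rho> t \<omega>))"
    using integrable_distr[OF rho_measurable[OF assms(1)], of v] assms
    by (simp add: rho_distr[OF assms(1)])
  show "(\<integral>\<omega>. v (\<rho> t \<omega>) \<partial>M) = (\<integral>r. v r \<partial>\<Gamma>)"
    using integral_distr[OF rho_measurable[OF assms(1)], of v] assms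
    by (simp add: rho_distr[OF assms(1)])
qed

text \<open>By nonexpansiveness, the distance of \<open>x t\<close> to the fixed point
  \<open>prox_h 0\<close> is at most the norm of the mean of the \<open>z t i\<close>.\<close>

lemma x_square_integrable_if:
  assumes "\<And>i. i \<in> {1..n} \<Longrightarrow> square_integrable M (z t i)"
  shows "square_integrable M (x t)"
proof -
  let ?m = "\<lambda>\<omega>. (1 / real n) *\<^sub>R (\<Sum>i=1..n. z t i \<omega>)"
  have m: "square_integrable M ?m"
    by (intro square_integrable_scaleR square_integrable_sum assms)
  have "square_integrable M (\<lambda>\<omega>. x t \<omega> - prox_h 0)"
  proof (rule square_integrable_dominated[OF m])
    have "x t \<in> borel_measurable M"
      by (rule x_measurable_if) (use assms in \<open>auto simp: square_integrable_def\<close>)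
    then show "(\<lambda>\<omega>. x t \<omega> - prox_h 0) \<in> borel_measurable M" by simp
    show "norm (x t \<omega> - prox_h 0) \<le> norm (?m \<omega>)" for \<omega>
      using prox_h_nonexpansive[of "?m \<omega>" 0] by (simp add: x_eq)
  qed
  from square_integrable_add[OF this square_integrable_const[of "prox_h 0"]]
  show ?thesis by simp
qed

text \<open>The Lipschitz bound compares with the gradient at \<open>xstar\<close>, the only point
  where a second moment is assumed.\<close>

lemma gradt_x_square_integrable:
  assumes i: "i \<in> {1..n}" and X: "square_integrable M (x t)"
  shows "square_integrable M (\<lambda>\<omega>. gradt i (x t \<omega>) (\<rho> (Suc t) \<omega>))"
proof (rule square_integrable_dominated)
  have rho [measurable]: "\<rho> (Suc t) \<in> M \<rightarrow>\<^sub>M \<Gamma>" by (rule rho_measurable) simp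
  have Xm: "x t \<in> borel_measurable M" using X by (simp add: square_integrable_def)
  have "square_integrable M (\<lambda>\<omega>. gradt i xstar (\<rho> (Suc t) \<omega>))"
    using gradt_square_integrable[OF i] gradt_compose_measurable[OF i, of "\<lambda>_. xstar" M "\<rho> (Suc t)"]
      rho_compose_integrable(1)[of "Suc t" "\<lambda>r. (norm (gradt i xstar r))\<^sup>2"]
    by (simp add: square_integrable_def rho)
  then show "square_integrable M (\<lambda>\<omega>. norm (gradt i xstar (\<rho> (Suc t) \<omega>))
      + L i *\<^sub>R norm (x t \<omega> - xstar))"
    by (intro square_integrable_add square_integrable_scaleR square_integrable_norm
        square_integrable_diff X square_integrable_const)
  show "(\<lambda>\<omega>. gradt i (x t \<omega>) (\<rho> (Suc t) \<omega>)) \<in> borel_measurable M"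
    by (rule gradt_compose_measurable[OF i Xm rho])
  fix \<omega> assume "\<omega> \<in> space M"
  then have "\<rho> (Suc t) \<omega> \<in> space \<Gamma>" using rho by (rule measurable_space[rotated])
  from gradt_lipschitz[OF i this, of "x t \<omega>" xstar]
  show "norm (gradt i (x t \<omega>) (\<rho> (Suc t) \<omega>))
      \<le> norm (norm (gradt i xstar (\<rho> (Suc t) \<omega>)) + L i *\<^sub>R norm (x t \<omega> - xstar))"
    using norm_triangle_sub[of "gradt i (x t \<omega>) (\<rho> (Suc t) \<omega>)" "gradt i xstar (\<rho> (Suc t) \<omega>)"]
    by simp
qed

lemma z_square_integrable: "i \<in> {1..n} \<Longrightarrow> square_integrable M (z t i)"
proof (induction t arbitrary: i)
  case 0
  then show ?case
    using z0_measurable z0_square_integrable by (simp add: square_integrable_def)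
next
  case (Suc t)
  have X: "square_integrable M (x t)" by (rule x_square_integrable_if[OF Suc.IH])
  let ?y = "\<lambda>\<omega>. (1 - stepsize (Suc t) i) *\<^sub>R z t i \<omega> + stepsize (Suc t) i *\<^sub>R
      (x t \<omega> - (1 / \<mu>) *\<^sub>R gradt i (x t \<omega>) (\<rho> (Suc t) \<omega>))"
  have "square_integrable M ?y"
    by (intro square_integrable_add square_integrable_scaleR square_integrable_diff
        Suc.IH[OF Suc.prems] X gradt_x_square_integrable[OF Suc.prems])
  \<comment> \<open>The sum of the norms of both branches dominates the update whichever branch is
    taken, so the event that selects \<open>i\<close> need not be treated.\<close>
  from square_integrable_add[OF square_integrable_norm[OF this]
      square_integrable_norm[OF Suc.IH[OF Suc.prems]]]
  have "square_integrable M (\<lambda>\<omega>. norm (?y \<omega>) + norm (z t i \<omega>))" .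
  then show ?case
  proof (rule square_integrable_dominated)
    show "z (Suc t) i \<in> borel_measurable M"
      by (rule measurable_past_imp[OF z_measurable_past[OF Suc.prems]])
  qed (simp add: z_Suc)
qed

lemma x_square_integrable: "square_integrable M (x t)"
  by (rule x_square_integrable_if[OF z_square_integrable])

lemma ft_x_integrable:
  assumes i: "i \<in> {1..n}"
  shows "integrable M (\<lambda>\<omega>. ft i (x t \<omega>) (\<rho> (Suc t) \<omega>))"
proof (rule Bochner_Integration.integrable_bound)
  have rho [measurable]: "\<rho> (Suc t) \<in> M \<rightarrow>\<^sub>M \<Gamma>" by (rule rho_measurable) simp
  have "integrable \<Gamma> (\<lambda>r. \<bar>ft i xstar r\<bar> + 1 / 2 * (norm (gradt i xstar r))\<^sup>2)"
    using ft_integrable[OF i, of xstar] gradt_square_integrable[OF i]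
    by (simp add: square_integrable_def)
  from rho_compose_integrable(1)[OF _ this, of "Suc t"]
  show "integrable M (\<lambda>\<omega>. \<bar>ft i xstar (\<rho> (Suc t) \<omega>)\<bar>
      + 1 / 2 * (norm (gradt i xstar (\<rho> (Suc t) \<omega>)))\<^sup>2 + (L i + 1) / 2 * (norm (x t \<omega> - xstar))\<^sup>2)"
    by (intro Bochner_Integration.integrable_add[of _ "\<lambda>\<omega>. \<bar>ft i xstar (\<rho> (Suc t) \<omega>)\<bar>
          + 1 / 2 * (norm (gradt i xstar (\<rho> (Suc t) \<omega>)))\<^sup>2"]
        Bochner_Integration.integrable_mult_right square_integrable_integrable_sq
        square_integrable_diff x_square_integrable square_integrable_const) auto
  show "(\<lambda>\<omega>. ft i (x t \<omega>) (\<rho> (Suc t) \<omega>)) \<in> borel_measurable M"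
    by (rule ft_compose_measurable[OF i _ rho]) (rule measurable_past_imp[OF x_measurable_past])
  show "AE \<omega> in M. norm (ft i (x t \<omega>) (\<rho> (Suc t) \<omega>)) \<le> norm (\<bar>ft i xstar (\<rho> (Suc t) \<omega>)\<bar>
      + 1 / 2 * (norm (gradt i xstar (\<rho> (Suc t) \<omega>)))\<^sup>2 + (L i + 1) / 2 * (norm (x t \<omega> - xstar))\<^sup>2)"
  proof (rule AE_I2)
    fix \<omega> assume "\<omega> \<in> space M"
    then have "\<rho> (Suc t) \<omega> \<in> space \<Gamma>" using rho by (rule measurable_space[rotated])
    from ft_growth[OF i this, of "x t \<omega>" xstar]
    show "norm (ft i (x t \<omega>) (\<rho> (Suc t) \<omega>)) \<le> norm (\<bar>ft i xstar (\<rho> (Suc t) \<omega>)\<bar>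
      + 1 / 2 * (norm (gradt i xstar (\<rho> (Suc t) \<omega>)))\<^sup>2 + (L i + 1) / 2 * (norm (x t \<omega> - xstar))\<^sup>2)"
      by simp
  qed
qed

lemma d_integrable: "i \<in> {1..n} \<Longrightarrow> integrable M (\<lambda>\<omega>. d t i \<omega> u)"
proof (induction t)
  case 0
  have "integrable M (\<lambda>\<omega>. (norm (u - z 0 i \<omega>))\<^sup>2)"
    by (intro square_integrable_integrable_sq square_integrable_diff square_integrable_const
        z_square_integrable 0)
  then show ?case using c0_integrable[OF 0] by simp
next
  case (Suc t)
  let ?y = "\<lambda>\<omega>. (1 - stepsize (Suc t) i) * d t i \<omega> u + stepsize (Suc t) i *
      (ft i (x t \<omega>) (\<rho> (Suc t) \<omega>) + gradt i (x t \<omega>) (\<rho> (Suc t) \<omega>) \<bullet> (u - x t \<omega>)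
       + \<mu> / 2 * (norm (u - x t \<omega>))\<^sup>2)"
  have "integrable M ?y"
    by (intro Bochner_Integration.integrable_add Bochner_Integration.integrable_mult_right
        square_integrable_inner square_integrable_integrable_sq square_integrable_diff
        square_integrable_const x_square_integrable gradt_x_square_integrable ft_x_integrable
        Suc impI)
  from Bochner_Integration.integrable_add[OF integrable_abs[OF this]
      integrable_abs[OF Suc.IH[OF Suc.prems]]]
  have "integrable M (\<lambda>\<omega>. \<bar>?y \<omega>\<bar> + \<bar>d t i \<omega> u\<bar>)" .
  then show ?case
  proof (rule Bochner_Integration.integrable_bound)
    show "(\<lambda>\<omega>. d (Suc t) i \<omega> u) \<in> borel_measurable M"
      by (rule measurable_past_imp[OF d_measurable_past[OF Suc.prems]])
  qed simp
qed

text \<open>The induction for \<open>d\<close> works at a fixed argument; \<open>d_quadratic\<close>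
  then moves from 0 to the random argument.\<close>

lemma d_x_integrable:
  assumes "i \<in> {1..n}"
  shows "integrable M (\<lambda>\<omega>. d t i \<omega> (x t \<omega>))"
proof -
  have "d t i \<omega> (x t \<omega>) = d t i \<omega> 0 + (\<mu> / 2 * (norm (x t \<omega>))\<^sup>2 - \<mu> * (z t i \<omega> \<bullet> x t \<omega>))" for \<omega>
    using d_quadratic[of t i \<omega> "x t \<omega>" 0] by simp
  moreover have "integrable M (\<lambda>\<omega>. d t i \<omega> 0
      + (\<mu> / 2 * (norm (x t \<omega>))\<^sup>2 - \<mu> * (z t i \<omega> \<bullet> x t \<omega>)))"
    by (intro Bochner_Integration.integrable_add Bochner_Integration.integrable_diff
        Bochner_Integration.integrable_mult_right square_integrable_inner
        square_integrable_integrable_sq x_square_integrable z_square_integrable d_integrable assms)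
  ultimately show ?thesis by simp
qed

text \<open>Two subgradient inequalities sandwich \<open>h (x t \<omega>)\<close>: optimality of
  \<open>xstar\<close> from below, and the variational inequality at \<open>x t \<omega>\<close>,
  tested at \<open>xstar\<close>, from above.\<close>

lemma h_x_integrable: "integrable M (\<lambda>\<omega>. h (x t \<omega>))"
proof (rule Bochner_Integration.integrable_bound)
  let ?m = "\<lambda>\<omega>. (1 / real n) *\<^sub>R (\<Sum>i=1..n. z t i \<omega>)"
  let ?s = "(1 / real n) *\<^sub>R (\<Sum>i=1..n. gradient (fi i) xstar)"
  show "integrable M (\<lambda>\<omega>. \<bar>h xstar\<bar> + \<bar>?s \<bullet> (x t \<omega> - xstar)\<bar>
      + \<bar>\<mu> * ((x t \<omega> - ?m \<omega>) \<bullet> (xstar - x t \<omega>))\<bar>)"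
    by (intro Bochner_Integration.integrable_add integrable_abs
        Bochner_Integration.integrable_mult_right square_integrable_inner square_integrable_diff
        square_integrable_scaleR square_integrable_sum square_integrable_const
        x_square_integrable z_square_integrable integrable_const)
  show "(\<lambda>\<omega>. h (x t \<omega>)) \<in> borel_measurable M"
    by (rule borel_measurable_continuous_on[OF continuous_h])
       (rule measurable_past_imp[OF x_measurable_past])
  have "\<bar>h (x t \<omega>)\<bar> \<le> \<bar>h xstar\<bar> + \<bar>?s \<bullet> (x t \<omega> - xstar)\<bar>
      + \<bar>\<mu> * ((x t \<omega> - ?m \<omega>) \<bullet> (xstar - x t \<omega>))\<bar>" for \<omega>
    using xstar_subgradient[of "x t \<omega>"] prox_h_variational[of "?m \<omega>" xstar]
    unfolding x_eq[symmetric] by linarith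
  then show "AE \<omega> in M. norm (h (x t \<omega>)) \<le> norm (\<bar>h xstar\<bar> + \<bar>?s \<bullet> (x t \<omega> - xstar)\<bar>
      + \<bar>\<mu> * ((x t \<omega> - ?m \<omega>) \<bullet> (xstar - x t \<omega>))\<bar>)"
    by simp
qed

lemma z_zstar_integrable: "i \<in> {1..n} \<Longrightarrow> integrable M (\<lambda>\<omega>. (norm (z t i \<omega> - zstar i))\<^sup>2)"
  by (intro square_integrable_integrable_sq square_integrable_diff square_integrable_const
      z_square_integrable)

lemma D_x_integrable: "integrable M (\<lambda>\<omega>. D t \<omega> (x t \<omega>))"
  unfolding D_def
  by (intro Bochner_Integration.integrable_add Bochner_Integration.integrable_mult_right
      Bochner_Integration.integrable_sum d_x_integrable h_x_integrable)

lemma lyapunov_integrable: "integrable M (lyapunov t)"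
  unfolding lyapunov_def[abs_def]
  by (intro Bochner_Integration.integrable_add Bochner_Integration.integrable_diff
      integrable_const Bochner_Integration.integrable_mult_right
      Bochner_Integration.integrable_sum D_x_integrable z_zstar_integrable)

section \<open>Independence of the past and the fresh sample\<close>

definition hit :: "nat \<Rightarrow> nat \<Rightarrow> 'w \<Rightarrow> real" where
  "hit t i \<omega> = of_bool (idx (Suc t) \<omega> = i)"

text \<open>\<open>hit t\<close> is labelled by the past that precedes it: the index is the one
  drawn at iteration \<open>Suc t\<close>.\<close>

lemma hit_integral:
  "has_bochner_integral M (hit t i) (pmf q i)"
proof -
  have idx: "idx (Suc t) \<in> M \<rightarrow>\<^sub>M count_space UNIV" by (rule idx_measurable) simp
  have "has_bochner_integral (measure_pmf q) (indicator {i} :: nat \<Rightarrow> real) (pmf q i)"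
    using has_bochner_integral_real_indicator[of "{i}" "measure_pmf q"]
    by (simp add: measure_pmf_single measure_pmf.emeasure_finite top.not_eq_extremum[symmetric])
  then have "has_bochner_integral (distr M (count_space UNIV) (idx (Suc t)))
      (indicator {i} :: nat \<Rightarrow> real) (pmf q i)"
    by (simp add: idx_distr)
  moreover have "hit t i = (\<lambda>\<omega>. indicator {i} (idx (Suc t) \<omega>))"
    by (auto simp: hit_def indicator_def fun_eq_iff)
  ultimately show ?thesis
    using integrable_distr_eq[OF idx, of "indicator {i} :: nat \<Rightarrow> real"]
      integral_distr[OF idx, of "indicator {i} :: nat \<Rightarrow> real"]
    by (simp add: has_bochner_integral_iff)
qed

text \<open>The sources fall into three disjoint blocks, namely those up to time t, the next index
  and the next perturbation. The source algebras are intersection stable, so the sigma-algebras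
  generated by the blocks are independent.\<close>

lemma indep_past_hit_rho:
  fixes u :: "'w \<Rightarrow> real" and v :: "'r \<Rightarrow> real"
  assumes u: "u \<in> borel_measurable (past t)" and v: "v \<in> borel_measurable \<Gamma>"
  shows "indep_vars (\<lambda>_. borel)
    (\<lambda>k. if k = 0 then u else if k = 1 then hit t i else (\<lambda>\<omega>. v (\<rho> (Suc t) \<omega>))) {0, 1, 2::nat}"
    (is "indep_vars _ ?X ?J")
  unfolding indep_vars_def2
proof
  let ?S = "\<lambda>k. if k = 0 then past_sources t
    else if k = 1 then {Index (Suc t)} else {Perturbation (Suc t)}"
  let ?G = "\<lambda>k::nat. sigma_sets (space M) (\<Union>s\<in>?S k. sets (source_algebra s))"
  have "(\<Union>k\<in>?J. ?S k) \<subseteq> {Initial} \<union> Index ` {1..} \<union> Perturbation ` {1..}"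
    by (auto simp: past_sources_def)
  then have "indep_sets (\<lambda>s. sets (source_algebra s)) (\<Union>k\<in>?J. ?S k)"
    using indep_sources by (rule indep_sets_mono_index)
  then have G: "indep_sets ?G ?J"
  proof (rule indep_sets_collect_sigma)
    show "Int_stable (sets (source_algebra s))" for s by (rule sets.Int_stable)
    show "disjoint_family_on ?S ?J"
      by (auto simp: disjoint_family_on_def past_sources_def)
  qed
  have idx: "idx (Suc t) \<in> source_algebra (Index (Suc t)) \<rightarrow>\<^sub>M count_space UNIV"
    unfolding source_algebra_def source.case by (rule measurable_vimage_algebra1) auto
  have rho: "\<rho> (Suc t) \<in> source_algebra (Perturbation (Suc t)) \<rightarrow>\<^sub>M \<Gamma>"
    unfolding source_algebra_def source.case
    by (rule measurable_vimage_algebra1)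
       (use rho_measurable[of "Suc t", THEN measurable_space] in auto)
  have "hit t i \<in> borel_measurable (source_algebra (Index (Suc t)))"
    unfolding hit_def[abs_def] using idx by measurable
  moreover have "(\<lambda>\<omega>. v (\<rho> (Suc t) \<omega>)) \<in> borel_measurable (source_algebra (Perturbation (Suc t)))"
    using rho v by measurable
  ultimately have vimage: "?X k -` A \<inter> space M \<in> ?G k" if "k \<in> ?J" "A \<in> sets borel" for k A
    using that u[THEN measurable_sets, of A]
    by (auto simp: sets_past dest!: measurable_sets[of _ _ _ A])
  show "indep_sets (\<lambda>k. {?X k -` A \<inter> space M |A. A \<in> sets borel}) ?J"
    by (rule indep_sets_mono_sets[OF G]) (use vimage in blast)
  have G_sets: "?G k \<subseteq> sets M" if "k \<in> ?J" for k
    using G[unfolded indep_sets_def, THEN conjunct1] that by (rule bspec)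
  show "\<forall>k\<in>?J. random_variable borel (?X k)"
  proof (intro ballI measurableI)
    fix k A assume "k \<in> ?J" "A \<in> sets (borel :: real measure)"
    then show "?X k -` A \<inter> space M \<in> sets M" using G_sets vimage by (meson subsetD)
  qed simp
qed

lemma past_hit_rho_integral:
  fixes u :: "'w \<Rightarrow> real" and v :: "'r \<Rightarrow> real"
  assumes u: "u \<in> borel_measurable (past t)" "integrable M u" and v: "integrable \<Gamma> v"
  shows "has_bochner_integral M (\<lambda>\<omega>. hit t i \<omega> * (u \<omega> * v (\<rho> (Suc t) \<omega>)))
    (pmf q i * ((\<integral>\<omega>. u \<omega> \<partial>M) * (\<integral>r. v r \<partial>\<Gamma>)))"
proof -
  let ?X = "\<lambda>k. if k = 0 then u else if k = (1::nat) then hit t i else (\<lambda>\<omega>. v (\<rho> (Suc t) \<omega>))"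
  note indep = indep_past_hit_rho[OF u(1) borel_measurable_integrable[OF v], of i]
  have X: "integrable M (?X k)" for k
    using u(2) hit_integral[of t i] rho_compose_integrable(1)[OF _ v, of "Suc t"]
    by (simp add: has_bochner_integral_iff)
  show ?thesis
    using indep_vars_integrable[OF _ indep X] indep_vars_lebesgue_integral[OF _ indep X]
      hit_integral[of t i] rho_compose_integrable(2)[OF _ v, of "Suc t"]
    by (simp add: has_bochner_integral_iff algebra_simps)
qed

text \<open>The substitute for conditioning on the past: under the integral, the fresh index and
  perturbation are replaced by their means while \<open>u\<close> and \<open>w\<close> stay random,
  so the rest of the estimate can be made pointwise. Both sides are shown to equal
  \<open>?I\<close>.\<close>

lemma sampled_integral:
  fixes w :: "'w \<Rightarrow> 'a" and g :: "nat \<Rightarrow> 'r \<Rightarrow> 'a"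
  assumes u: "\<And>i. i \<in> {1..n} \<Longrightarrow> u i \<in> borel_measurable (past t)"
      "\<And>i. i \<in> {1..n} \<Longrightarrow> integrable M (u i)"
    and v: "\<And>i. i \<in> {1..n} \<Longrightarrow> integrable \<Gamma> (v i)"
    and w: "w \<in> borel_measurable (past t)" "integrable M w"
    and g: "\<And>i. i \<in> {1..n} \<Longrightarrow> integrable \<Gamma> (g i)"
  shows "integrable M (\<lambda>\<omega>. \<Sum>i=1..n. hit t i \<omega> * (u i \<omega> + v i (\<rho> (Suc t) \<omega>) + w \<omega> \<bullet> g i (\<rho> (Suc t) \<omega>)))"
      (is "integrable M ?f")
    and "integrable M (\<lambda>\<omega>. \<Sum>i=1..n. pmf q i * (u i \<omega> + (\<integral>r. v i r \<partial>\<Gamma>) + w \<omega> \<bullet> (\<integral>r. g i r \<partial>\<Gamma>)))"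
      (is "integrable M ?f'")
    and "(\<integral>\<omega>. (\<Sum>i=1..n. hit t i \<omega> * (u i \<omega> + v i (\<rho> (Suc t) \<omega>) + w \<omega> \<bullet> g i (\<rho> (Suc t) \<omega>))) \<partial>M)
      = (\<integral>\<omega>. (\<Sum>i=1..n. pmf q i * (u i \<omega> + (\<integral>r. v i r \<partial>\<Gamma>) + w \<omega> \<bullet> (\<integral>r. g i r \<partial>\<Gamma>))) \<partial>M)"
proof -
  let ?I = "\<Sum>i=1..n. pmf q i * ((\<integral>\<omega>. u i \<omega> \<partial>M) + (\<integral>r. v i r \<partial>\<Gamma>) + (\<integral>\<omega>. w \<omega> \<partial>M) \<bullet> (\<integral>r. g i r \<partial>\<Gamma>))"
  have "has_bochner_integral M
      (\<lambda>\<omega>. hit t i \<omega> * (u i \<omega> + v i (\<rho> (Suc t) \<omega>) + w \<omega> \<bullet> g i (\<rho> (Suc t) \<omega>)))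
      (pmf q i * ((\<integral>\<omega>. u i \<omega> \<partial>M) + (\<integral>r. v i r \<partial>\<Gamma>) + (\<integral>\<omega>. w \<omega> \<partial>M) \<bullet> (\<integral>r. g i r \<partial>\<Gamma>)))"
    if i: "i \<in> {1..n}" for i
  proof -
    have 1: "has_bochner_integral M (\<lambda>\<omega>. hit t i \<omega> * u i \<omega>) (pmf q i * (\<integral>\<omega>. u i \<omega> \<partial>M))"
      using past_hit_rho_integral[OF u[OF i], of "\<lambda>_. 1" i] by (simp add: Gamma.prob_space)
    have 2: "has_bochner_integral M (\<lambda>\<omega>. hit t i \<omega> * v i (\<rho> (Suc t) \<omega>)) (pmf q i * (\<integral>r. v i r \<partial>\<Gamma>))"
      using past_hit_rho_integral[OF borel_measurable_const integrable_const v[OF i], of t i 1]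
      by (simp add: prob_space)
    \<comment> \<open>The product rule is for real factors, so the inner product is expanded over
      the basis.\<close>
    have 3: "has_bochner_integral M
        (\<lambda>\<omega>. \<Sum>b\<in>Basis. hit t i \<omega> * ((w \<omega> \<bullet> b) * (g i (\<rho> (Suc t) \<omega>) \<bullet> b)))
        (\<Sum>b\<in>Basis. pmf q i * (((\<integral>\<omega>. w \<omega> \<partial>M) \<bullet> b) * ((\<integral>r. g i r \<partial>\<Gamma>) \<bullet> b)))"
    proof (rule has_bochner_integral_sum)
      fix b :: 'a
      have "(\<lambda>\<omega>. w \<omega> \<bullet> b) \<in> borel_measurable (past t)" using w(1) by measurable
      from past_hit_rho_integral[OF this, of "\<lambda>r. g i r \<bullet> b" i]
      show "has_bochner_integral M (\<lambda>\<omega>. hit t i \<omega> * ((w \<omega> \<bullet> b) * (g i (\<rho> (Suc t) \<omega>) \<bullet> b)))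
        (pmf q i * (((\<integral>\<omega>. w \<omega> \<partial>M) \<bullet> b) * ((\<integral>r. g i r \<partial>\<Gamma>) \<bullet> b)))"
        using w(2) g[OF i] by (simp add: integral_inner_left integrable_inner_left)
    qed
    note sum_rule = has_bochner_integral_add[OF has_bochner_integral_add[OF 1 2] 3]
    have inner: "c * (a1 + a2 + (y1 \<bullet> y2))
        = c * a1 + c * a2 + (\<Sum>b\<in>Basis. c * ((y1 \<bullet> b) * (y2 \<bullet> b)))" for c a1 a2 and y1 y2 :: 'a
      by (simp only: distrib_left sum_distrib_left[symmetric] euclidean_inner[of y1 y2])
    show ?thesis
      by (subst (1 2) inner) (rule sum_rule)
  qed
  then have f: "has_bochner_integral M ?f ?I" by (intro has_bochner_integral_sum)
  have "has_bochner_integral M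
      (\<lambda>\<omega>. pmf q i * (u i \<omega> + (\<integral>r. v i r \<partial>\<Gamma>) + w \<omega> \<bullet> (\<integral>r. g i r \<partial>\<Gamma>)))
      (pmf q i * ((\<integral>\<omega>. u i \<omega> \<partial>M) + (\<integral>r. v i r \<partial>\<Gamma>) + (\<integral>\<omega>. w \<omega> \<partial>M) \<bullet> (\<integral>r. g i r \<partial>\<Gamma>)))"
    if i: "i \<in> {1..n}" for i
    using u(2)[OF i] w(2)
    by (simp add: has_bochner_integral_iff prob_space integrable_inner_left integral_inner_left)
  then have f': "has_bochner_integral M ?f' ?I" by (intro has_bochner_integral_sum)
  from f show "integrable M ?f" by (simp add: has_bochner_integral_iff)
  from f' show "integrable M ?f'" by (simp add: has_bochner_integral_iff)
  from f f' show "integral\<^sup>L M ?f = integral\<^sup>L M ?f'" by (simp add: has_bochner_integral_iff)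
qed

section \<open>One step of the surrogate and of the Lyapunov function\<close>

lemma n_pos: "real n > 0" using n_ge_1 by simp

text \<open>The mean of the \<open>d t i \<omega>\<close> is, up to a constant, \<mu>/2 times the
  squared distance to the mean of the \<open>z t i \<omega>\<close>. Expanding it exactly around
  \<open>x t \<omega>\<close> leaves the quadratic gain and a linear term that the variational
  inequality for h controls.\<close>

lemma D_strong_minimum: "D t \<omega> (x t \<omega>) + \<mu> / 2 * (norm (y - x t \<omega>))\<^sup>2 \<le> D t \<omega> y"
proof -
  let ?X = "x t \<omega>" and ?m = "(1 / real n) *\<^sub>R (\<Sum>i=1..n. z t i \<omega>)"
  have "(\<Sum>i=1..n. d t i \<omega> y) - (\<Sum>i=1..n. d t i \<omega> ?X)
      = real n * (\<mu> / 2 * ((norm y)\<^sup>2 - (norm ?X)\<^sup>2)) - \<mu> * ((\<Sum>i=1..n. z t i \<omega>) \<bullet> (y - ?X))"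
    unfolding sum_subtractf[symmetric] d_quadratic
    by (simp add: sum_subtractf inner_sum_left sum_distrib_left)
  then have "1 / real n * (\<Sum>i=1..n. d t i \<omega> y) - 1 / real n * (\<Sum>i=1..n. d t i \<omega> ?X)
      = 1 / real n * (real n * (\<mu> / 2 * ((norm y)\<^sup>2 - (norm ?X)\<^sup>2))
          - \<mu> * ((\<Sum>i=1..n. z t i \<omega>) \<bullet> (y - ?X)))"
    by (simp add: diff_divide_distrib[symmetric])
  also have "\<dots> = \<mu> / 2 * ((norm y)\<^sup>2 - (norm ?X)\<^sup>2) - \<mu> * (?m \<bullet> (y - ?X))"
    using n_pos by (simp add: field_simps)
  finally have "1 / real n * (\<Sum>i=1..n. d t i \<omega> y) - 1 / real n * (\<Sum>i=1..n. d t i \<omega> ?X)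
      = \<mu> / 2 * ((norm y)\<^sup>2 - (norm ?X)\<^sup>2) - \<mu> * (?m \<bullet> (y - ?X))" .
  moreover have "h ?X - \<mu> * ((?X - ?m) \<bullet> (y - ?X)) \<le> h y"
    using prox_h_variational[of ?m y] unfolding x_eq[symmetric] .
  moreover have "(norm (y - ?X))\<^sup>2 = (norm y)\<^sup>2 - (norm ?X)\<^sup>2 - 2 * (?X \<bullet> (y - ?X))"
    using norm_diff_sq_diff[of y ?X ?X] by simp
  then have "\<mu> / 2 * (norm (y - ?X))\<^sup>2
      = \<mu> / 2 * ((norm y)\<^sup>2 - (norm ?X)\<^sup>2) - \<mu> * (?X \<bullet> (y - ?X))"
    by (simp only:) (simp add: right_diff_distrib)
  ultimately show ?thesis
    by (simp add: D_def inner_diff_left algebra_simps)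
qed

lemma D_step_lower:
  assumes i: "i \<in> {1..n}" and idx: "idx (Suc t) \<omega> = i"
  shows "D t \<omega> (x t \<omega>)
      + stepsize (Suc t) i / real n * (ft i (x t \<omega>) (\<rho> (Suc t) \<omega>) - d t i \<omega> (x t \<omega>))
      - \<mu> / (2 * (real n)\<^sup>2) * (norm (z (Suc t) i \<omega> - z t i \<omega>))\<^sup>2
    \<le> D (Suc t) \<omega> (x (Suc t) \<omega>)"
proof -
  let ?X = "x t \<omega>" and ?Y = "x (Suc t) \<omega>" and ?a = "stepsize (Suc t) i"
  let ?f = "ft i ?X (\<rho> (Suc t) \<omega>)"
  define e where "e = z (Suc t) i \<omega> - z t i \<omega>"
  have "(\<Sum>j=1..n. d (Suc t) j \<omega> ?Y)
      = (\<Sum>j=1..n. d t j \<omega> ?Y) + (d (Suc t) i \<omega> ?Y - d t i \<omega> ?Y)"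
    by (rule sum_change_one[OF _ i]) (use idx in auto)
  \<comment> \<open>Equal curvatures make the change of \<open>d i\<close> affine, with slope
    \<open>- \<mu> *\<^sub>R e\<close>.\<close>
  also have "d (Suc t) i \<omega> ?Y - d t i \<omega> ?Y
      = d (Suc t) i \<omega> ?X - d t i \<omega> ?X - \<mu> * (e \<bullet> (?Y - ?X))"
    using d_quadratic[of "Suc t" i \<omega> ?Y ?X] d_quadratic[of t i \<omega> ?Y ?X]
    by (simp add: e_def inner_diff_left right_diff_distrib del: d.simps)
  \<comment> \<open>At \<open>?X\<close> the new model reduces to its value
    \<open>?f\<close>.\<close>
  also have "d (Suc t) i \<omega> ?X - d t i \<omega> ?X = ?a * (?f - d t i \<omega> ?X)"
    using idx by (simp add: algebra_simps)
  finally have "D (Suc t) \<omega> ?Y = D t \<omega> ?Y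
      + 1 / real n * (?a * (?f - d t i \<omega> ?X) - \<mu> * (e \<bullet> (?Y - ?X)))"
    by (simp add: D_def distrib_left del: d.simps)
  moreover have "D t \<omega> ?X + \<mu> / 2 * (norm (?Y - ?X))\<^sup>2 \<le> D t \<omega> ?Y"
    by (rule D_strong_minimum)
  \<comment> \<open>Completing the square in the move of x: the quadratic growth of
    \<open>D t\<close> absorbs the linear term up to \<mu> / (2 n^2) times the squared norm of
    \<open>e\<close>.\<close>
  moreover have "0 \<le> \<mu> / 2 * (norm (?Y - ?X - (1 / real n) *\<^sub>R e))\<^sup>2" using mu_pos by simp
  moreover have "\<mu> / 2 * (norm (?Y - ?X - (1 / real n) *\<^sub>R e))\<^sup>2
      = \<mu> / 2 * (norm (?Y - ?X))\<^sup>2 - 1 / real n * (\<mu> * (e \<bullet> (?Y - ?X)))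
        + \<mu> / (2 * (real n)\<^sup>2) * (norm e)\<^sup>2"
  proof -
    have "(norm (u - c *\<^sub>R e))\<^sup>2 = (norm u)\<^sup>2 - 2 * c * (e \<bullet> u) + c\<^sup>2 * (norm e)\<^sup>2" for u c
      unfolding power2_norm_eq_inner
      by (simp add: inner_diff_left inner_diff_right inner_commute power2_eq_square algebra_simps)
    from this[of "?Y - ?X" "1 / real n"] show ?thesis
      by (simp add: distrib_left right_diff_distrib power_divide mult_ac)
  qed
  moreover have "1 / real n * (?a * (?f - d t i \<omega> ?X) - \<mu> * (e \<bullet> (?Y - ?X)))
      = ?a / real n * (?f - d t i \<omega> ?X) - 1 / real n * (\<mu> * (e \<bullet> (?Y - ?X)))"
    by (simp add: right_diff_distrib)
  ultimately show ?thesis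
    unfolding e_def[symmetric] by linarith
qed

text \<open>Importance weighting: the mean weight of an update is the same for every index.\<close>

lemma stepsize_pmf: "i \<in> {1..n} \<Longrightarrow> pmf q i > 0 \<and> pmf q i * stepsize t i = \<alpha> t / real n"
  using q_support by (auto simp: stepsize_def pmf_positive_iff set_pmf_iff pmf_pos)

text \<open>The distance part of the Lyapunov function without its step-size factor, so that one
  step can be analysed under the new \<open>\<alpha> (Suc t)\<close> and compared with
  \<open>\<alpha> t\<close> afterwards.\<close>

definition residual :: "nat \<Rightarrow> 'w \<Rightarrow> real" where
  "residual t \<omega> = (\<Sum>i=1..n. 1 / (pmf q i * real n) * (norm (z t i \<omega> - zstar i))\<^sup>2)"

lemma residual_step:
  assumes i: "i \<in> {1..n}" and idx: "idx (Suc t) \<omega> = i"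
  shows "residual (Suc t) \<omega> = residual t \<omega>
    + 1 / (pmf q i * real n) * ((norm (z (Suc t) i \<omega> - zstar i))\<^sup>2 - (norm (z t i \<omega> - zstar i))\<^sup>2)"
proof -
  show ?thesis
    unfolding residual_def right_diff_distrib
    by (rule sum_change_one[OF _ i]) (use idx in \<open>auto simp: z_Suc\<close>)
qed

lemma lyapunov_residual:
  "lyapunov t \<omega> = F xstar - D t \<omega> (x t \<omega>) + \<mu> * \<alpha> t / (real n)\<^sup>2 * residual t \<omega>"
  by (simp add: lyapunov_def residual_def)

text \<open>The Bregman divergence cancels \<open>ft i (x t \<omega>)\<close>, so that the bound is a sum of products of a
  function of the past and a function of the new perturbation.\<close>

lemma lyapunov_step_pointwise:
  fixes t \<omega> i
  defines "r \<equiv> \<rho> (Suc t) \<omega>" and "a \<equiv> stepsize (Suc t) i"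
  assumes \<omega>: "\<omega> \<in> space M" and i: "i \<in> {1..n}" and idx: "idx (Suc t) \<omega> = i"
    and a: "0 \<le> a" "a \<le> 1 / 2" "4 * (a * (L i - \<mu>)) \<le> \<mu> * real n"
  shows "lyapunov (Suc t) \<omega>
    \<le> F xstar - D t \<omega> (x t \<omega>) + \<mu> * \<alpha> (Suc t) / (real n)\<^sup>2 * residual t \<omega>
      + (a / real n * (d t i \<omega> (x t \<omega>) - \<mu> / 2 * (norm (x t \<omega> - xstar))\<^sup>2)
          - \<mu> * a\<^sup>2 / (real n)\<^sup>2 * (norm (z t i \<omega> - zstar i))\<^sup>2)
      + (2 * a\<^sup>2 / (\<mu> * (real n)\<^sup>2) * (norm (gradt i xstar r - gradient (fi i) xstar))\<^sup>2
          - a / real n * ft i xstar r)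
      - a / real n * ((x t \<omega> - xstar) \<bullet> gradt i xstar r)"
proof -
  let ?X = "x t \<omega>"
  have r: "r \<in> space \<Gamma>" unfolding r_def using rho_measurable[of "Suc t", THEN measurable_space] \<omega> by simp
  define y where "y = ?X - (1 / \<mu>) *\<^sub>R gradt i ?X r"
  define Y where "Y = (norm (y - zstar i))\<^sup>2"
  define W where "W = (norm (y - z t i \<omega>))\<^sup>2"
  define Z where "Z = (norm (z t i \<omega> - zstar i))\<^sup>2"
  define N where "N = (norm (gradt i xstar r - gradient (fi i) xstar))\<^sup>2"
  define B where "B = ft i ?X r - ft i xstar r - gradt i xstar r \<bullet> (?X - xstar)
      - \<mu> / 2 * (norm (?X - xstar))\<^sup>2"
  have B: "0 \<le> B" using ft_lower_quadratic[OF i r, of xstar ?X] by (simp add: B_def)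
  have W: "0 \<le> W" by (simp add: W_def)
  have zS: "z (Suc t) i \<omega> = (1 - a) *\<^sub>R z t i \<omega> + a *\<^sub>R y"
    using idx by (simp add: z_Suc y_def a_def r_def)
  have z1: "(norm (z (Suc t) i \<omega> - z t i \<omega>))\<^sup>2 = a\<^sup>2 * W"
    using norm_convex_combination_sq[of a "z t i \<omega>" y "z t i \<omega>"]
    unfolding zS W_def by (simp add: power2_eq_square algebra_simps)
  have z2: "(norm (z (Suc t) i \<omega> - zstar i))\<^sup>2 - Z = a * (Y - Z - (1 - a) * W)"
    unfolding zS norm_convex_combination_sq Y_def W_def Z_def by (simp add: algebra_simps)
  have dev: "\<mu>\<^sup>2 * Y \<le> 4 * (L i - \<mu>) * B + 2 * N"
    using gradient_step_deviation[OF i r, of ?X] unfolding Y_def y_def B_def N_def .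
  have "a\<^sup>2 * (\<mu>\<^sup>2 * Y) \<le> a * (4 * (a * (L i - \<mu>))) * B + 2 * a\<^sup>2 * N"
    using mult_left_mono[OF dev, of "a\<^sup>2"] by (simp add: power2_eq_square algebra_simps)
  \<comment> \<open>The second step-size condition enters here, with B nonnegative by strong
    convexity. After division the coefficient of B is a / n, exactly that of \<open>ft i\<close> in
    \<open>D_step_lower\<close>.\<close>
  also have "\<dots> \<le> a * (\<mu> * real n) * B + 2 * a\<^sup>2 * N"
    using a B by (intro add_right_mono mult_right_mono mult_left_mono) auto
  finally have "a\<^sup>2 * (\<mu>\<^sup>2 * Y) / (\<mu> * (real n)\<^sup>2) \<le> (a * (\<mu> * real n) * B + 2 * a\<^sup>2 * N) / (\<mu> * (real n)\<^sup>2)"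
    using mu_pos by (intro divide_right_mono) auto
  then have Ybound: "\<mu> * a\<^sup>2 / (real n)\<^sup>2 * Y \<le> a / real n * B + 2 * a\<^sup>2 / (\<mu> * (real n)\<^sup>2) * N"
    using mu_pos n_pos by (simp add: power2_eq_square add_divide_distrib mult_ac)
  \<comment> \<open>The condition a \<le> 1/2: the loss in the surrogate is covered by the convexity
    defect.\<close>
  have Wbound: "\<mu> / (2 * (real n)\<^sup>2) * (a\<^sup>2 * W) \<le> \<mu> * a\<^sup>2 / (real n)\<^sup>2 * ((1 - a) * W)"
  proof -
    have "(\<mu> * a\<^sup>2 / (real n)\<^sup>2) * (1 / 2 * W) \<le> (\<mu> * a\<^sup>2 / (real n)\<^sup>2) * ((1 - a) * W)"
      using a W mu_pos by (intro mult_left_mono mult_right_mono) auto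
    then show ?thesis by (simp add: mult_ac)
  qed
  \<comment> \<open>For the sampled index, the Lyapunov weight times \<open>\<alpha> (Suc t)\<close>
    is a itself, so the change of the distance acquires the factor a^2.\<close>
  have "\<mu> * \<alpha> (Suc t) / (real n)\<^sup>2 * residual (Suc t) \<omega>
      = \<mu> * \<alpha> (Suc t) / (real n)\<^sup>2 * residual t \<omega>
        + \<mu> * a / (real n)\<^sup>2 * (a * (Y - Z - (1 - a) * W))"
    unfolding residual_step[OF i idx] Z_def[symmetric] z2
    by (simp add: distrib_left a_def stepsize_def)
  also have "\<mu> * a / (real n)\<^sup>2 * (a * (Y - Z - (1 - a) * W)) = \<mu> * a\<^sup>2 / (real n)\<^sup>2 * Y
      - \<mu> * a\<^sup>2 / (real n)\<^sup>2 * Z - \<mu> * a\<^sup>2 / (real n)\<^sup>2 * ((1 - a) * W)"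
    by (simp add: power2_eq_square right_diff_distrib diff_divide_distrib mult_ac)
  finally have res: "\<mu> * \<alpha> (Suc t) / (real n)\<^sup>2 * residual (Suc t) \<omega>
      = \<mu> * \<alpha> (Suc t) / (real n)\<^sup>2 * residual t \<omega> + (\<mu> * a\<^sup>2 / (real n)\<^sup>2 * Y
      - \<mu> * a\<^sup>2 / (real n)\<^sup>2 * Z - \<mu> * a\<^sup>2 / (real n)\<^sup>2 * ((1 - a) * W))" .
  have "D t \<omega> ?X + a / real n * (ft i ?X r - d t i \<omega> ?X) - \<mu> / (2 * (real n)\<^sup>2) * (a\<^sup>2 * W)
      \<le> D (Suc t) \<omega> (x (Suc t) \<omega>)"
    using D_step_lower[OF i idx] unfolding z1 a_def r_def .
  then have "lyapunov (Suc t) \<omega>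
    \<le> F xstar - D t \<omega> ?X + \<mu> * \<alpha> (Suc t) / (real n)\<^sup>2 * residual t \<omega>
      - a / real n * (ft i ?X r - d t i \<omega> ?X) - \<mu> * a\<^sup>2 / (real n)\<^sup>2 * Z
      + a / real n * B + 2 * a\<^sup>2 / (\<mu> * (real n)\<^sup>2) * N"
    unfolding lyapunov_residual using res Ybound Wbound by linarith
  also have "\<dots> = F xstar - D t \<omega> ?X + \<mu> * \<alpha> (Suc t) / (real n)\<^sup>2 * residual t \<omega>
      + (a / real n * (d t i \<omega> ?X - \<mu> / 2 * (norm (?X - xstar))\<^sup>2) - \<mu> * a\<^sup>2 / (real n)\<^sup>2 * Z)
      + (2 * a\<^sup>2 / (\<mu> * (real n)\<^sup>2) * N - a / real n * ft i xstar r)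
      - a / real n * ((?X - xstar) \<bullet> gradt i xstar r)"
    unfolding B_def by (simp add: algebra_simps inner_commute)
  finally show ?thesis unfolding Z_def N_def .
qed

section \<open>Expectation of the one-step bound\<close>

lemma AE_idx: "AE \<omega> in M. idx (Suc t) \<omega> \<in> {1..n}"
proof -
  have "AE i in distr M (count_space UNIV) (idx (Suc t)). i \<in> {1..n}"
    using AE_measure_pmf[of q] unfolding q_support by (subst idx_distr) auto
  then show ?thesis
    by (rule AE_distrD[OF idx_measurable, rotated]) simp
qed

lemma d_x_measurable_past:
  assumes "i \<in> {1..n}"
  shows "(\<lambda>\<omega>. d t i \<omega> (x t \<omega>)) \<in> borel_measurable (past t)"
proof -
  have "d t i \<omega> (x t \<omega>) = d t i \<omega> 0 + (\<mu> / 2 * (norm (x t \<omega>))\<^sup>2 - \<mu> * (z t i \<omega> \<bullet> x t \<omega>))" for \<omega>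
    using d_quadratic[of t i \<omega> "x t \<omega>" 0] by simp
  moreover have "(\<lambda>\<omega>. d t i \<omega> 0 + (\<mu> / 2 * (norm (x t \<omega>))\<^sup>2 - \<mu> * (z t i \<omega> \<bullet> x t \<omega>)))
      \<in> borel_measurable (past t)"
    using d_measurable_past[OF assms] x_measurable_past z_measurable_past[OF assms] by measurable
  ultimately show ?thesis by simp
qed

lemma residual_nonneg: "0 \<le> residual t \<omega>"
  unfolding residual_def by (intro sum_nonneg) simp

lemma residual_integrable: "integrable M (residual t)"
  unfolding residual_def[abs_def]
  by (intro Bochner_Integration.integrable_sum Bochner_Integration.integrable_mult_right
      z_zstar_integrable)

text \<open>A pointwise inequality for the step bound after averaging over the fresh sample. The
  distance term first contracts with the new weight A, and A \<le> \<alpha> t then restores the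
  weight in \<open>lyapunov t\<close>.\<close>

lemma conditional_expectation_bound:
  fixes t \<omega>
  defines "A \<equiv> \<alpha> (Suc t)"
  assumes A: "0 < A" "A \<le> \<alpha> t" "A \<le> real n"
  shows "F xstar - D t \<omega> (x t \<omega>) + \<mu> * A / (real n)\<^sup>2 * residual t \<omega>
      + (\<Sum>i=1..n. pmf q i *
          ((stepsize (Suc t) i / real n * (d t i \<omega> (x t \<omega>) - \<mu> / 2 * (norm (x t \<omega> - xstar))\<^sup>2)
              - \<mu> * (stepsize (Suc t) i)\<^sup>2 / (real n)\<^sup>2 * (norm (z t i \<omega> - zstar i))\<^sup>2)
            + (2 * (stepsize (Suc t) i)\<^sup>2 / (\<mu> * (real n)\<^sup>2) * noise_var i
              - stepsize (Suc t) i / real n * fi i xstar)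
            + (x t \<omega> - xstar) \<bullet> (- (stepsize (Suc t) i / real n) *\<^sub>R gradient (fi i) xstar)))
    \<le> (1 - A / real n) * lyapunov t \<omega>
      + 2 * (A / real n)\<^sup>2 * ((1 / real n * (\<Sum>i=1..n. noise_var i / (pmf q i * real n))) / \<mu>)"
proof -
  let ?X = "x t \<omega>" and ?a = "stepsize (Suc t)"
  let ?s = "(1 / real n) *\<^sub>R (\<Sum>i=1..n. gradient (fi i) xstar)"
  define E where "E = (norm (?X - xstar))\<^sup>2"
  define Z where "Z i = (norm (z t i \<omega> - zstar i))\<^sup>2" for i
  define N where "N = 1 / real n * (\<Sum>i=1..n. noise_var i / (pmf q i * real n))"
  have term_eq: "pmf q i * ((?a i / real n * (d t i \<omega> ?X - \<mu> / 2 * E) - \<mu> * (?a i)\<^sup>2 / (real n)\<^sup>2 * Z i)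
      + (2 * (?a i)\<^sup>2 / (\<mu> * (real n)\<^sup>2) * noise_var i - ?a i / real n * fi i xstar)
      + (?X - xstar) \<bullet> (- (?a i / real n) *\<^sub>R gradient (fi i) xstar))
    = A / (real n)\<^sup>2 * (d t i \<omega> ?X - \<mu> / 2 * E - fi i xstar - gradient (fi i) xstar \<bullet> (?X - xstar))
      - A / real n * (\<mu> * A / (real n)\<^sup>2) * (1 / (pmf q i * real n) * Z i)
      + 2 * (A / real n)\<^sup>2 / (real n * \<mu>) * (noise_var i / (pmf q i * real n))"
    if i: "i \<in> {1..n}" for i
  proof -
    have q: "pmf q i * ?a i = A / real n" "pmf q i \<noteq> 0" using stepsize_pmf[OF i, of "Suc t"] by (auto simp: A_def)
    \<comment> \<open>The remaining factor 1 / q_i produces the weights 1 / (q_i n) of both the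
      residual and the noise.\<close>
    have q2: "pmf q i * (?a i)\<^sup>2 = (A / real n)\<^sup>2 / pmf q i"
      using q(2) unfolding q(1)[symmetric] by (simp add: power2_eq_square)
    have inner: "(?X - xstar) \<bullet> (- (?a i / real n) *\<^sub>R gradient (fi i) xstar)
        = - (?a i / real n) * (gradient (fi i) xstar \<bullet> (?X - xstar))"
      by (simp add: inner_commute)
    have "pmf q i * ((?a i / real n * (d t i \<omega> ?X - \<mu> / 2 * E) - \<mu> * (?a i)\<^sup>2 / (real n)\<^sup>2 * Z i)
      + (2 * (?a i)\<^sup>2 / (\<mu> * (real n)\<^sup>2) * noise_var i - ?a i / real n * fi i xstar)
      + (?X - xstar) \<bullet> (- (?a i / real n) *\<^sub>R gradient (fi i) xstar))
      = (pmf q i * ?a i) * ((d t i \<omega> ?X - \<mu> / 2 * E - fi i xstar - gradient (fi i) xstar \<bullet> (?X - xstar)) / real n)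
        - (pmf q i * (?a i)\<^sup>2) * (\<mu> / (real n)\<^sup>2 * Z i)
        + (pmf q i * (?a i)\<^sup>2) * (2 / (\<mu> * (real n)\<^sup>2) * noise_var i)"
      unfolding inner by (simp add: diff_divide_distrib add_divide_distrib ring_distribs mult_ac)
    then show ?thesis
      unfolding q(1) q2 by (simp add: power2_eq_square mult_ac)
  qed
  have "1 / real n * (\<Sum>i=1..n. d t i \<omega> ?X - \<mu> / 2 * E - fi i xstar - gradient (fi i) xstar \<bullet> (?X - xstar))
      = D t \<omega> ?X - h ?X - \<mu> / 2 * E - (F xstar - h xstar) - ?s \<bullet> (?X - xstar)"
    using n_pos
    by (simp add: D_def F_def sum_subtractf inner_sum_left diff_divide_distrib right_diff_distrib)
  \<comment> \<open>By optimality, linearizing the smooth part at \<open>xstar\<close> and keeping h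
    gives at least \<open>F xstar\<close> at \<open>?X\<close>; the strong convexity term has a
    favourable sign and is dropped.\<close>
  also have "\<dots> \<le> D t \<omega> ?X - F xstar"
  proof -
    have "0 \<le> \<mu> / 2 * E" using mu_pos by (simp add: E_def)
    then show ?thesis using xstar_subgradient[of ?X] by linarith
  qed
  finally have "A / real n * (1 / real n * (\<Sum>i=1..n. d t i \<omega> ?X - \<mu> / 2 * E - fi i xstar
        - gradient (fi i) xstar \<bullet> (?X - xstar)))
      \<le> A / real n * (D t \<omega> ?X - F xstar)"
    using A n_pos by (intro mult_left_mono) auto
  then have main: "A / (real n)\<^sup>2 * (\<Sum>i=1..n. d t i \<omega> ?X - \<mu> / 2 * E - fi i xstar
        - gradient (fi i) xstar \<bullet> (?X - xstar))
      \<le> A / real n * (D t \<omega> ?X - F xstar)"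
    by (simp add: power2_eq_square)
  have sum_eq: "(\<Sum>i=1..n. pmf q i *
      ((?a i / real n * (d t i \<omega> ?X - \<mu> / 2 * E) - \<mu> * (?a i)\<^sup>2 / (real n)\<^sup>2 * Z i)
      + (2 * (?a i)\<^sup>2 / (\<mu> * (real n)\<^sup>2) * noise_var i - ?a i / real n * fi i xstar)
      + (?X - xstar) \<bullet> (- (?a i / real n) *\<^sub>R gradient (fi i) xstar)))
    = A / (real n)\<^sup>2 * (\<Sum>i=1..n. d t i \<omega> ?X - \<mu> / 2 * E - fi i xstar - gradient (fi i) xstar \<bullet> (?X - xstar))
      - A / real n * (\<mu> * A / (real n)\<^sup>2) * residual t \<omega>
      + 2 * (A / real n)\<^sup>2 / (real n * \<mu>) * (\<Sum>i=1..n. noise_var i / (pmf q i * real n))"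
    (is "?lhs = _")
  proof -
    have "?lhs = (\<Sum>i=1..n. A / (real n)\<^sup>2
          * (d t i \<omega> ?X - \<mu> / 2 * E - fi i xstar - gradient (fi i) xstar \<bullet> (?X - xstar))
        - A / real n * (\<mu> * A / (real n)\<^sup>2) * (1 / (pmf q i * real n) * Z i)
        + 2 * (A / real n)\<^sup>2 / (real n * \<mu>) * (noise_var i / (pmf q i * real n)))"
      by (rule sum.cong[OF refl term_eq])
    then show ?thesis
      unfolding residual_def Z_def[symmetric]
      by (simp only: sum.distrib sum_subtractf sum_distrib_left[symmetric])
  qed
  have noise_eq: "2 * (A / real n)\<^sup>2 / (real n * \<mu>) * (\<Sum>i=1..n. noise_var i / (pmf q i * real n))
      = 2 * (A / real n)\<^sup>2 * (N / \<mu>)"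
    by (simp add: N_def)
  \<comment> \<open>Here k = A / n, e and f are the surrogate minimum and the optimal value, and P
    and Q are the distance terms with weights A and \<open>\<alpha> t\<close>. Multiplying P \<le> Q
    by 1 - k requires A \<le> n.\<close>
  have arith: "f - e + P + (k * (e - f) - k * P + c) \<le> (1 - k) * (f - e + Q) + c"
    if "(1 - k) * P \<le> (1 - k) * Q" for f e P k c Q :: real
    using that by (simp add: algebra_simps)
  have "(1 - A / real n) * (\<mu> * A / (real n)\<^sup>2 * residual t \<omega>)
      \<le> (1 - A / real n) * (\<mu> * \<alpha> t / (real n)\<^sup>2 * residual t \<omega>)"
    using A n_pos mu_pos residual_nonneg[of t \<omega>]
    by (intro mult_left_mono mult_right_mono divide_right_mono) auto
  then have "F xstar - D t \<omega> ?X + \<mu> * A / (real n)\<^sup>2 * residual t \<omega>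
      + (A / real n * (D t \<omega> ?X - F xstar)
      - A / real n * (\<mu> * A / (real n)\<^sup>2) * residual t \<omega> + 2 * (A / real n)\<^sup>2 * (N / \<mu>))
      \<le> (1 - A / real n) * lyapunov t \<omega> + 2 * (A / real n)\<^sup>2 * (N / \<mu>)"
    unfolding lyapunov_residual using arith by (simp only: mult.assoc)
  then show ?thesis
    unfolding E_def[symmetric] Z_def[symmetric] N_def[symmetric] sum_eq noise_eq
    using main by linarith
qed

lemma lyapunov_expectation_step:
  assumes A: "0 < \<alpha> (Suc t)" "\<alpha> (Suc t) \<le> \<alpha> t" "\<alpha> (Suc t) \<le> real n"
    and a: "\<And>i. i \<in> {1..n} \<Longrightarrow> stepsize (Suc t) i \<le> 1 / 2"
      "\<And>i. i \<in> {1..n} \<Longrightarrow> 4 * (stepsize (Suc t) i * (L i - \<mu>)) \<le> \<mu> * real n"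
  shows "(\<integral>\<omega>. lyapunov (Suc t) \<omega> \<partial>M) \<le> (1 - \<alpha> (Suc t) / real n) * (\<integral>\<omega>. lyapunov t \<omega> \<partial>M)
      + 2 * (\<alpha> (Suc t) / real n)\<^sup>2
          * ((1 / real n * (\<Sum>i=1..n. noise_var i / (pmf q i * real n))) / \<mu>)"
proof -
  let ?a = "stepsize (Suc t)" and ?A = "\<alpha> (Suc t)"
  let ?c = "2 * (?A / real n)\<^sup>2 * ((1 / real n * (\<Sum>i=1..n. noise_var i / (pmf q i * real n))) / \<mu>)"
  define b where "b \<omega> = F xstar - D t \<omega> (x t \<omega>) + \<mu> * ?A / (real n)\<^sup>2 * residual t \<omega>" for \<omega>
  define u where "u i \<omega> = ?a i / real n * (d t i \<omega> (x t \<omega>) - \<mu> / 2 * (norm (x t \<omega> - xstar))\<^sup>2)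
      - \<mu> * (?a i)\<^sup>2 / (real n)\<^sup>2 * (norm (z t i \<omega> - zstar i))\<^sup>2" for i \<omega>
  define v where "v i r = 2 * (?a i)\<^sup>2 / (\<mu> * (real n)\<^sup>2)
        * (norm (gradt i xstar r - gradient (fi i) xstar))\<^sup>2
      - ?a i / real n * ft i xstar r" for i r
  define w where "w \<omega> = x t \<omega> - xstar" for \<omega>
  define g where "g i r = - (?a i / real n) *\<^sub>R gradt i xstar r" for i r
  let ?S = "\<lambda>\<omega>. \<Sum>i=1..n. hit t i \<omega> * (u i \<omega> + v i (\<rho> (Suc t) \<omega>) + w \<omega> \<bullet> g i (\<rho> (Suc t) \<omega>))"
  let ?S' = "\<lambda>\<omega>. \<Sum>i=1..n. pmf q i * (u i \<omega> + (\<integral>r. v i r \<partial>\<Gamma>) + w \<omega> \<bullet> (\<integral>r. g i r \<partial>\<Gamma>))"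
  have sq: "square_integrable M w" unfolding w_def[abs_def]
    by (intro square_integrable_diff x_square_integrable square_integrable_const)
  have w: "w \<in> borel_measurable (past t)" "integrable M w"
    using x_measurable_past[of t] square_integrable_integrable[OF sq] by (auto simp: w_def[abs_def])
  have u: "u i \<in> borel_measurable (past t)" "integrable M (u i)" if i: "i \<in> {1..n}" for i
  proof -
    show "u i \<in> borel_measurable (past t)"
      unfolding u_def[abs_def]
      using d_x_measurable_past[OF i, of t] x_measurable_past[of t] z_measurable_past[OF i, of t]
      by measurable
    show "integrable M (u i)"
      unfolding u_def[abs_def] w_def[symmetric]
      by (intro Bochner_Integration.integrable_diff Bochner_Integration.integrable_mult_right
          d_x_integrable z_zstar_integrable square_integrable_integrable_sq sq i)
  qed
  have v: "integrable \<Gamma> (v i)" "(\<integral>r. v i r \<partial>\<Gamma>) = 2 * (?a i)\<^sup>2 / (\<mu> * (real n)\<^sup>2) * noise_var i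
      - ?a i / real n * fi i xstar" if i: "i \<in> {1..n}" for i
    unfolding v_def[abs_def] noise_var_def fi_def[symmetric]
    using noise_integrable[OF i] ft_integrable[OF i, of xstar]
    by (simp_all add: fi_def)
  have g: "integrable \<Gamma> (g i)" "(\<integral>r. g i r \<partial>\<Gamma>) = - (?a i / real n) *\<^sub>R gradient (fi i) xstar"
    if i: "i \<in> {1..n}" for i
    unfolding g_def[abs_def] gradient_fi[OF i] using gradt_integrable[OF i, of xstar] by simp_all
  note sampled = sampled_integral[of u t v w g, OF u v(1) w g(1)]
  have b: "integrable M b"
    unfolding b_def[abs_def]
    by (intro Bochner_Integration.integrable_add Bochner_Integration.integrable_diff
        Bochner_Integration.integrable_mult_right integrable_const D_x_integrable
        residual_integrable)
  have "(\<integral>\<omega>. lyapunov (Suc t) \<omega> \<partial>M) \<le> (\<integral>\<omega>. b \<omega> + ?S \<omega> \<partial>M)"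
  proof (rule integral_mono_AE)
    \<comment> \<open>Only almost everywhere, since the index may leave \<open>{1..n}\<close> on a
      null set. Elsewhere \<open>hit\<close> selects exactly one summand of
      \<open>?S\<close>.\<close>
    show "AE \<omega> in M. lyapunov (Suc t) \<omega> \<le> b \<omega> + ?S \<omega>"
      using AE_idx[of t] AE_space
    proof eventually_elim
      case (elim \<omega>)
      define i where "i = idx (Suc t) \<omega>"
      have i: "i \<in> {1..n}" using elim by (simp add: i_def)
      have "?S \<omega> = (\<Sum>j\<in>{1..n}. if j = i then
          u j \<omega> + v j (\<rho> (Suc t) \<omega>) + w \<omega> \<bullet> g j (\<rho> (Suc t) \<omega>) else 0)"
        by (rule sum.cong) (auto simp: hit_def i_def)
      also have "\<dots> = u i \<omega> + v i (\<rho> (Suc t) \<omega>) + w \<omega> \<bullet> g i (\<rho> (Suc t) \<omega>)"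
        using i by simp
      finally have S: "?S \<omega> = u i \<omega> + v i (\<rho> (Suc t) \<omega>) + w \<omega> \<bullet> g i (\<rho> (Suc t) \<omega>)" .
      have "0 \<le> ?a i" using A(1) n_pos by (simp add: stepsize_def)
      from lyapunov_step_pointwise[OF elim(2) i i_def[symmetric] this a[OF i]]
      moreover have "w \<omega> \<bullet> g i (\<rho> (Suc t) \<omega>)
          = - (?a i / real n * ((x t \<omega> - xstar) \<bullet> gradt i xstar (\<rho> (Suc t) \<omega>)))"
        by (simp add: w_def g_def)
      ultimately show ?case
        unfolding S unfolding b_def u_def v_def by linarith
    qed
  qed (use b sampled(1) lyapunov_integrable in auto)
  also have "\<dots> = (\<integral>\<omega>. b \<omega> + ?S' \<omega> \<partial>M)"
    using b sampled by simp
  also have "\<dots> \<le> (\<integral>\<omega>. (1 - ?A / real n) * lyapunov t \<omega> + ?c \<partial>M)"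
  proof (rule integral_mono)
    fix \<omega>
    have "?S' \<omega> = (\<Sum>i=1..n. pmf q i * (u i \<omega>
        + (2 * (?a i)\<^sup>2 / (\<mu> * (real n)\<^sup>2) * noise_var i - ?a i / real n * fi i xstar)
        + w \<omega> \<bullet> (- (?a i / real n) *\<^sub>R gradient (fi i) xstar)))"
      by (rule sum.cong) (simp_all add: v(2) g(2))
    then show "b \<omega> + ?S' \<omega> \<le> (1 - ?A / real n) * lyapunov t \<omega> + ?c"
      using conditional_expectation_bound[OF A, of \<omega>] unfolding b_def u_def w_def by simp
  qed (use b sampled(2) lyapunov_integrable in auto)
  also have "\<dots> = (1 - ?A / real n) * (\<integral>\<omega>. lyapunov t \<omega> \<partial>M) + ?c"
    using lyapunov_integrable[of t] by (simp add: prob_space)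
  finally show ?thesis .
qed

end

theorem proposition5:
  fixes M :: "'w measure" and \<Gamma> :: "'r measure" and n :: nat
    and ft :: "nat \<Rightarrow> real ^ 'p \<Rightarrow> 'r \<Rightarrow> real" and h :: "real ^ 'p \<Rightarrow> real"
    and \<mu> :: real and L :: "nat \<Rightarrow> real" and xstar :: "real ^ 'p"
    and q :: "nat pmf" and \<alpha> :: "nat \<Rightarrow> real"
    and \<rho>0 :: "nat \<Rightarrow> 'w \<Rightarrow> 'r" and z0 :: "nat \<Rightarrow> 'w \<Rightarrow> real ^ 'p" and c0 :: "nat \<Rightarrow> 'w \<Rightarrow> real"
    and idx :: "nat \<Rightarrow> 'w \<Rightarrow> nat" and \<rho> :: "nat \<Rightarrow> 'w \<Rightarrow> 'r"
    and q_min L_q sigma_q_sq :: real and C :: "nat \<Rightarrow> 'w \<Rightarrow> real"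
  assumes smiso: "smiso M n \<Gamma> ft h \<mu> L xstar q \<alpha> \<rho>0 z0 c0 idx \<rho>"
    and q_min: "q_min = (MIN i\<in>{1..n}. pmf q i)"
    and L_q: "L_q = (MAX i\<in>{1..n}. (L i - \<mu>) / (pmf q i * real n))"
    and sigma_q_sq: "sigma_q_sq = 1 / real n *
      (\<Sum>i=1..n. composite_finite_sum.noise_var \<Gamma> ft xstar i / (pmf q i * real n))"
    and C: "C = smiso_process.lyapunov n \<Gamma> ft h \<mu> xstar q \<alpha> z0 c0 idx \<rho>"
    and alpha_pos: "\<And>t. t \<ge> 1 \<Longrightarrow> \<alpha> t > 0"
    and alpha_noninc: "\<And>s t. 1 \<le> s \<Longrightarrow> s \<le> t \<Longrightarrow> \<alpha> t \<le> \<alpha> s"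
    and alpha_0: "\<alpha> 0 \<ge> \<alpha> 1"
    and alpha_bound: "\<alpha> 1 \<le> (if L_q = 0 then real n * q_min / 2
                        else min (real n * q_min / 2) (real n * \<mu> / (4 * L_q)))"
  shows "(\<forall>t. integrable M (C t)) \<and>
    (\<forall>t\<ge>1. (\<integral>\<omega>. C t \<omega> \<partial>M)
      \<le> (1 - \<alpha> t / real n) * (\<integral>\<omega>. C (t - 1) \<omega> \<partial>M)
         + 2 * (\<alpha> t / real n)\<^sup>2 * (sigma_q_sq / \<mu>))"
proof -
  interpret smiso M n \<Gamma> ft h \<mu> L xstar q \<alpha> \<rho>0 z0 c0 idx \<rho> by (rule smiso)
  have "(\<integral>\<omega>. C (Suc t) \<omega> \<partial>M) \<le> (1 - \<alpha> (Suc t) / real n) * (\<integral>\<omega>. C t \<omega> \<partial>M)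
      + 2 * (\<alpha> (Suc t) / real n)\<^sup>2 * (sigma_q_sq / \<mu>)" for t
    unfolding C sigma_q_sq
  proof (rule lyapunov_expectation_step)
    let ?A = "\<alpha> (Suc t)"
    show pos: "0 < ?A" by (rule alpha_pos) simp
    show "?A \<le> \<alpha> t"
      \<comment> \<open>The case t = 0 is separate because the monotonicity hypothesis starts at
        1.\<close>
      using alpha_0 alpha_noninc[of t "Suc t"] by (cases t) auto
    have A1: "?A \<le> \<alpha> 1" by (rule alpha_noninc) auto
    have Aq: "?A \<le> real n * q_min / 2" using A1 alpha_bound by (auto split: if_splits)
    have Aqi: "?A \<le> real n * pmf q i / 2" if i: "i \<in> {1..n}" for i
    proof -
      have "q_min \<le> pmf q i" unfolding q_min using i by (intro Min_le) auto
      then have "real n * q_min / 2 \<le> real n * pmf q i / 2"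
        by (intro divide_right_mono mult_left_mono) auto
      then show ?thesis using Aq by simp
    qed
    \<comment> \<open>Any index would do; 1 exists because n \<ge> 1, and its probability is at most
      1.\<close>
    have "?A \<le> real n * pmf q 1 / 2" by (rule Aqi) (use n_ge_1 in simp)
    moreover have "real n * pmf q 1 \<le> real n" by (rule mult_left_le[OF pmf_le_1]) simp
    ultimately show "?A \<le> real n" using n_pos by linarith
    fix i assume i: "i \<in> {1..n}"
    have qi: "pmf q i > 0" using stepsize_pmf[OF i] by blast
    show "stepsize (Suc t) i \<le> 1 / 2"
      using Aqi[OF i] qi n_pos by (simp add: stepsize_def field_simps)
    have "(L i - \<mu>) / (pmf q i * real n) \<le> L_q" unfolding L_q using i by (intro Max_ge) auto
    then have "?A * ((L i - \<mu>) / (pmf q i * real n)) \<le> ?A * L_q"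
      using pos by (intro mult_left_mono) auto
    also have "?A * L_q \<le> real n * \<mu> / 4"
    proof (cases "L_q > 0")
      case True
      have "?A \<le> real n * \<mu> / (4 * L_q)" using A1 alpha_bound True by auto
      then show ?thesis using True by (simp add: field_simps)
    next
      case False
      \<comment> \<open>This covers L_q = 0, where the second bound stands for infinity: the product
        is already nonpositive.\<close>
      then have "?A * L_q \<le> 0" using pos by (simp add: mult_nonneg_nonpos)
      also have "0 \<le> real n * \<mu> / 4" using mu_pos by simp
      finally show ?thesis .
    qed
    finally show "4 * (stepsize (Suc t) i * (L i - \<mu>)) \<le> \<mu> * real n"
      by (simp add: stepsize_def mult.commute)
  qed
  then have "(\<integral>\<omega>. C t \<omega> \<partial>M) \<le> (1 - \<alpha> t / real n) * (\<integral>\<omega>. C (t - 1) \<omega> \<partial>M)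
         + 2 * (\<alpha> t / real n)\<^sup>2 * (sigma_q_sq / \<mu>)" if "t \<ge> 1" for t
    using that by (cases t) auto
  then show ?thesis using lyapunov_integrable by (simp add: C)
qed

end
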